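(* Let $F$ be an algebraically closed field, $l>1$ an integer coprime to the characteristic of $F$, $\xi\in F$ a primitive $l$-th root of $1$, and $I$ an infinite ordered set. Let $$Clg(l,I)=\langle x_i,\ i\in I \mid x_i^l=1;\ x_i^{-1}x_jx_i=\xi x_j \text{ for } i<j;\ x_i^{-1}x_jx_i=\xi^{-1}x_j \text{ for } i>j;\ i,j\in I\rangle.$$ Then $Clg(l,I)$ is a unital locally matrix algebra with Steinitz number $\mathbf{n}(Clg(l,I))=l^{\infty}$.
   Context: A unital algebra $A$ is locally matrix if every finite subset lies in a subalgebra $B$ with $1_A\in B$ and $B\cong M_n(F)$ for some $n$. $D(A)$ is the set of $n$ for which $A$ has a subalgebra containing $1_A$ isomorphic to $M_n(F)$, and $\mathbf{n}(A)$ is the least common multiple of $D(A)$ in the lattice of Steinitz numbers $\prod_p p^{r_p}$ ($r_p\in\mathbb{N}\cup\{0,\infty\}$, ordered by divisibility). $l^\infty$ denotes the Steinitz number with exponent $\infty$ at each prime dividing $l$ and $0$ at all other primes. *)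

theory Defs
  imports "HOL-Computational_Algebra.Polynomial" "HOL-Computational_Algebra.Primes"
    "HOL-Library.Extended_Nat" "Jordan_Normal_Form.Matrix"
begin

record ('a, 'b) falg =
  acarrier :: "'b set"
  aadd :: "'b \<Rightarrow> 'b \<Rightarrow> 'b"
  amul :: "'b \<Rightarrow> 'b \<Rightarrow> 'b"
  asmul :: "'a \<Rightarrow> 'b \<Rightarrow> 'b"
  azero :: 'b
  aone :: 'b

definition unital_algebra :: "('a::field, 'b) falg \<Rightarrow> bool" where
  "unital_algebra A \<longleftrightarrow>
     azero A \<in> acarrier A \<and> aone A \<in> acarrier A \<and>
     (\<forall>x\<in>acarrier A. \<forall>y\<in>acarrier A. aadd A x y \<in> acarrier A \<and> amul A x y \<in> acarrier A) \<and>
     (\<forall>c. \<forall>x\<in>acarrier A. asmul A c x \<in> acarrier A) \<and>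
     (\<forall>x\<in>acarrier A. \<forall>y\<in>acarrier A. \<forall>z\<in>acarrier A.
        aadd A (aadd A x y) z = aadd A x (aadd A y z) \<and>
        amul A (amul A x y) z = amul A x (amul A y z) \<and>
        amul A x (aadd A y z) = aadd A (amul A x y) (amul A x z) \<and>
        amul A (aadd A x y) z = aadd A (amul A x z) (amul A y z)) \<and>
     (\<forall>x\<in>acarrier A. \<forall>y\<in>acarrier A. aadd A x y = aadd A y x) \<and>
     (\<forall>x\<in>acarrier A. aadd A x (azero A) = x \<and> (\<exists>y\<in>acarrier A. aadd A x y = azero A)) \<and>
     (\<forall>x\<in>acarrier A. amul A (aone A) x = x \<and> amul A x (aone A) = x) \<and>
     (\<forall>c d. \<forall>x\<in>acarrier A. \<forall>y\<in>acarrier A.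
        asmul A c (aadd A x y) = aadd A (asmul A c x) (asmul A c y) \<and>
        asmul A (c + d) x = aadd A (asmul A c x) (asmul A d x) \<and>
        asmul A (c * d) x = asmul A c (asmul A d x) \<and>
        asmul A c (amul A x y) = amul A (asmul A c x) y \<and>
        asmul A c (amul A x y) = amul A x (asmul A c y)) \<and>
     (\<forall>x\<in>acarrier A. asmul A 1 x = x)"

definition subalgebra :: "('a::field, 'b) falg \<Rightarrow> 'b set \<Rightarrow> bool" where
  "subalgebra A B \<longleftrightarrow> B \<subseteq> acarrier A \<and> azero A \<in> B \<and>
     (\<forall>x\<in>B. \<forall>y\<in>B. aadd A x y \<in> B \<and> amul A x y \<in> B) \<and>
     (\<forall>c. \<forall>x\<in>B. asmul A c x \<in> B)"

definition matrix_subalgebra :: "('a::field, 'b) falg \<Rightarrow> nat \<Rightarrow> 'b set \<Rightarrow> bool" where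
  "matrix_subalgebra A n B \<longleftrightarrow> subalgebra A B \<and> aone A \<in> B \<and>
     (\<exists>\<phi>. bij_betw \<phi> (carrier_mat n n :: 'a mat set) B \<and>
        \<phi> (1\<^sub>m n) = aone A \<and>
        (\<forall>a\<in>carrier_mat n n. \<forall>b\<in>carrier_mat n n.
            \<phi> (a + b) = aadd A (\<phi> a) (\<phi> b) \<and> \<phi> (a * b) = amul A (\<phi> a) (\<phi> b)) \<and>
        (\<forall>c. \<forall>a\<in>carrier_mat n n. \<phi> (c \<cdot>\<^sub>m a) = asmul A c (\<phi> a)))"

definition locally_matrix :: "('a::field, 'b) falg \<Rightarrow> bool" where
  "locally_matrix A \<longleftrightarrow> unital_algebra A \<and>
     (\<forall>X. X \<subseteq> acarrier A \<and> finite X \<longrightarrow>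
        (\<exists>n B. n \<ge> 1 \<and> X \<subseteq> B \<and> matrix_subalgebra A n B))"

definition D_set :: "('a::field, 'b) falg \<Rightarrow> nat set" where
  "D_set A = {n. n \<ge> 1 \<and> (\<exists>B. matrix_subalgebra A n B)}"

text \<open>A Steinitz number \<open>\<Prod>_p p^{r_p}\<close> is represented by its exponent function
  \<open>p \<mapsto> r_p \<in> \<nat> \<union> {\<infinity>}\<close>, set to 0 at non-primes.  The least common multiple of a
  set of positive integers in the lattice of Steinitz numbers has exponent the supremum
  of the exponents.\<close>
type_synonym steinitz = "nat \<Rightarrow> enat"

definition steinitz_lcm :: "nat set \<Rightarrow> steinitz" where
  "steinitz_lcm S = (\<lambda>p. if prime p then (SUP n\<in>S. enat (multiplicity p n)) else 0)"

definition steinitz_number :: "('a::field, 'b) falg \<Rightarrow> steinitz" where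
  "steinitz_number A = steinitz_lcm (D_set A)"

definition steinitz_inf :: "nat \<Rightarrow> steinitz" where
  "steinitz_inf l = (\<lambda>p. if prime p \<and> p dvd l then \<infinity> else 0)"

text \<open>Elements of the free unital algebra \<open>F\<langle>x_i : i \<in> I\<rangle>\<close> are finitely supported
  functions from words (lists of generator indices) to \<open>F\<close>.\<close>
definition free_alg :: "('i list \<Rightarrow> 'a::field) set" where
  "free_alg = {f. finite {w. f w \<noteq> 0}}"

definition free_mult :: "('i list \<Rightarrow> 'a::field) \<Rightarrow> ('i list \<Rightarrow> 'a) \<Rightarrow> 'i list \<Rightarrow> 'a" where
  "free_mult f g w = (\<Sum>k\<le>length w. f (take k w) * g (drop k w))"

definition free_add :: "('i list \<Rightarrow> 'a::field) \<Rightarrow> ('i list \<Rightarrow> 'a) \<Rightarrow> 'i list \<Rightarrow> 'a" where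
  "free_add f g = (\<lambda>w. f w + g w)"

definition free_smul :: "'a::field \<Rightarrow> ('i list \<Rightarrow> 'a) \<Rightarrow> 'i list \<Rightarrow> 'a" where
  "free_smul c f = (\<lambda>w. c * f w)"

definition free_zero :: "'i list \<Rightarrow> 'a::field" where
  "free_zero = (\<lambda>w. 0)"

definition free_one :: "'i list \<Rightarrow> 'a::field" where
  "free_one = (\<lambda>w. if w = [] then 1 else 0)"

definition free_gen :: "'i \<Rightarrow> 'i list \<Rightarrow> 'a::field" where
  "free_gen i = (\<lambda>w. if w = [i] then 1 else 0)"

fun free_pow :: "('i list \<Rightarrow> 'a::field) \<Rightarrow> nat \<Rightarrow> 'i list \<Rightarrow> 'a" where
  "free_pow f 0 = free_one"
| "free_pow f (Suc n) = free_mult (free_pow f n) f"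

definition free_diff :: "('i list \<Rightarrow> 'a::field) \<Rightarrow> ('i list \<Rightarrow> 'a) \<Rightarrow> 'i list \<Rightarrow> 'a" where
  "free_diff f g = (\<lambda>w. f w - g w)"

inductive_set gen_ideal :: "('i list \<Rightarrow> 'a::field) set \<Rightarrow> ('i list \<Rightarrow> 'a) set"
  for R where
  zero: "free_zero \<in> gen_ideal R"
| gen: "r \<in> R \<Longrightarrow> a \<in> free_alg \<Longrightarrow> b \<in> free_alg \<Longrightarrow> free_mult (free_mult a r) b \<in> gen_ideal R"
| add: "x \<in> gen_ideal R \<Longrightarrow> y \<in> gen_ideal R \<Longrightarrow> free_add x y \<in> gen_ideal R"
| smul: "x \<in> gen_ideal R \<Longrightarrow> free_smul c x \<in> gen_ideal R"

definition coset_of :: "('i list \<Rightarrow> 'a::field) set \<Rightarrow> ('i list \<Rightarrow> 'a) \<Rightarrow> ('i list \<Rightarrow> 'a) set" where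
  "coset_of J f = {g\<in>free_alg. free_diff f g \<in> J}"

definition rep_of :: "('i list \<Rightarrow> 'a::field) set \<Rightarrow> 'i list \<Rightarrow> 'a" where
  "rep_of X = (SOME f. f \<in> X)"

definition presented_alg :: "('i list \<Rightarrow> 'a::field) set \<Rightarrow> ('a, ('i list \<Rightarrow> 'a) set) falg" where
  "presented_alg R = (let J = gen_ideal R in
     \<lparr> acarrier = coset_of J ` free_alg,
       aadd = (\<lambda>X Y. coset_of J (free_add (rep_of X) (rep_of Y))),
       amul = (\<lambda>X Y. coset_of J (free_mult (rep_of X) (rep_of Y))),
       asmul = (\<lambda>c X. coset_of J (free_smul c (rep_of X))),
       azero = coset_of J free_zero,
       aone = coset_of J free_one \<rparr>)"

text \<open>Relations \<open>x_i^l = 1\<close>, \<open>x_i^{-1} x_j x_i = \<xi> x_j\<close> (\<open>i < j\<close>),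
  \<open>x_i^{-1} x_j x_i = \<xi>^{-1} x_j\<close> (\<open>i > j\<close>); since \<open>x_i^l = 1\<close>, the inverse
  \<open>x_i^{-1}\<close> is \<open>x_i^{l-1}\<close>.\<close>
definition clg_rels :: "nat \<Rightarrow> 'a::field \<Rightarrow> ('i::linorder list \<Rightarrow> 'a) set" where
  "clg_rels l \<xi> =
     {free_diff (free_pow (free_gen i) l) free_one | i. True} \<union>
     {free_diff (free_mult (free_mult (free_pow (free_gen i) (l - 1)) (free_gen j)) (free_gen i))
                (free_smul \<xi> (free_gen j)) | i j. i < j} \<union>
     {free_diff (free_mult (free_mult (free_pow (free_gen i) (l - 1)) (free_gen j)) (free_gen i))
                (free_smul (inverse \<xi>) (free_gen j)) | i j. j < i}"

definition Clg :: "nat \<Rightarrow> 'a::field \<Rightarrow> ('a, ('i::linorder list \<Rightarrow> 'a) set) falg" where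
  "Clg l \<xi> = presented_alg (clg_rels l \<xi>)"

end

theory Submission
  imports Defs "Jordan_Normal_Form.Determinant"
begin

text \<open>
  The presented algebra is realised faithfully by linear operators on functions of multisets over
  \<open>I\<close>, where \<open>x_i\<close> shifts the multiplicity of \<open>i\<close> modulo \<open>l\<close> and multiplies by a power of \<open>\<xi>\<close>: modulo
  the relations every word is a scalar multiple of a sorted word with multiplicities below \<open>l\<close>, and
  these normal words act linearly independently.

  For \<open>2 m\<close> generators, matrix units of size \<open>l\<^sup>m\<close> are built by adjoining two generators \<open>x_a\<close>, \<open>x_b\<close>
  (\<open>a < b\<close>) below the previous ones. A multiple \<open>z\<close> of \<open>x_a\<^sup>-\<^sup>1 x_b\<close> satisfies \<open>z\<^sup>l = 1\<close>, commutes with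
  the previous generators, and \<open>z x_a = \<xi> x_a z\<close>. With the idempotent \<open>P = (1 + z + \<dots> + z\<^sup>l\<^sup>-\<^sup>1) / l\<close>
  the elements \<open>x_a\<^sup>c E_ij P x_a\<^sup>-\<^sup>d\<close> are matrix units of size \<open>l\<^sup>m\<^sup>+\<^sup>1\<close>. As \<open>I\<close> is infinite, every finite
  set lies in a copy of some \<open>M(l\<^sup>m)\<close>, for arbitrarily large \<open>m\<close>.

  A unital copy of \<open>M(n)\<close> lies in some \<open>M(l\<^sup>m)\<close>, and a unital homomorphism \<open>M(n) \<rightarrow> M(N)\<close> forces
  \<open>n dvd N\<close>, so \<open>n\<close> has only prime factors of \<open>l\<close>.
\<close>

section \<open>Matrix units in algebras\<close>

text \<open>The algebra is a whole type of class \<open>ring_1\<close>, so that ring reasoning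
  applies; the carrier-based \<open>falg\<close> records return only through the injective map of
  \<open>alg_embedding\<close>.\<close>

locale unital_alg =
  fixes sm :: "'a::field \<Rightarrow> 'r::ring_1 \<Rightarrow> 'r" (infixr "\<odot>" 75)
  assumes sm_add_left: "(a + b) \<odot> x = a \<odot> x + b \<odot> x"
    and sm_add_right: "a \<odot> (x + y) = a \<odot> x + a \<odot> y"
    and sm_sm [simp]: "a \<odot> (b \<odot> x) = (a * b) \<odot> x"
    and sm_one [simp]: "1 \<odot> x = x"
    and sm_mult_left [simp]: "(a \<odot> x) * y = a \<odot> (x * y)"
    and sm_mult_right [simp]: "x * (a \<odot> y) = a \<odot> (x * y)"
begin

lemma sm_zero_left [simp]: "0 \<odot> x = 0"
  using sm_add_left[of 0 0 x] by simp

lemma sm_zero_right [simp]: "a \<odot> 0 = 0"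
  using sm_add_right[of a 0 0] by simp

lemma sm_sum_left: "sum f A \<odot> x = (\<Sum>i\<in>A. f i \<odot> x)"
  by (induction A rule: infinite_finite_induct) (auto simp: sm_add_left)

lemma sm_sum_right: "a \<odot> sum f A = (\<Sum>i\<in>A. a \<odot> f i)"
  by (induction A rule: infinite_finite_induct) (auto simp: sm_add_right)

lemma sm_of_nat: "of_nat n \<odot> x = of_nat n * x"
  by (induction n) (auto simp: sm_add_left distrib_right)

lemma sm_uminus: "(- 1) \<odot> x = - x"
  using sm_add_left[of 1 "- 1" x] by (simp add: add_eq_0_iff)

lemma sm_cancel: "c \<noteq> 0 \<Longrightarrow> c \<odot> x = c \<odot> y \<longleftrightarrow> x = y"
  by (metis sm_sm sm_one field_class.field_inverse)

lemma sm_fixed_eq_zero: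
  assumes "x = c \<odot> x" "c \<noteq> 1"
  shows "x = 0"
proof -
  have "(1 - c) \<odot> x + c \<odot> x = x"
    unfolding sm_add_left[symmetric] by simp
  then have "(1 - c) \<odot> x = (1 - c) \<odot> 0" using assms(1) by simp
  then show ?thesis using assms(2) sm_cancel[of "1 - c" x 0] by simp
qed

lemma sm_power: "(a \<odot> x) ^ n = a ^ n \<odot> x ^ n"
  by (induction n) (auto simp: mult.commute)

lemma quasi_commute_power_right: "b * a = q \<odot> (a * b) \<Longrightarrow> b * a ^ n = q ^ n \<odot> (a ^ n * b)"
proof (induction n)
  case (Suc n)
  have "b * a ^ Suc n = (b * a) * a ^ n" by (simp add: mult.assoc)
  also have "\<dots> = q \<odot> (a * (b * a ^ n))" using Suc.prems by (simp add: mult.assoc)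
  also have "\<dots> = q ^ Suc n \<odot> (a ^ Suc n * b)"
    using Suc by (simp add: mult.assoc)
  finally show ?case .
qed simp

lemma quasi_commute_power_left: "b * a = q \<odot> (a * b) \<Longrightarrow> b ^ n * a = q ^ n \<odot> (a * b ^ n)"
proof (induction n)
  case (Suc n)
  have "b ^ Suc n * a = b * (b ^ n * a)" by (simp add: mult.assoc)
  also have "\<dots> = q ^ n \<odot> ((b * a) * b ^ n)"
    using Suc.IH[OF Suc.prems] by (simp add: mult.assoc)
  also have "\<dots> = q ^ Suc n \<odot> (a * b ^ Suc n)"
    unfolding Suc.prems by (simp add: mult.assoc mult.commute)
  finally show ?case .
qed simp

text \<open>Sorting the letters of \<open>(a * b) ^ n\<close> costs \<open>q\<close> to the power
  n(n-1)/2. Only the nonvanishing of this scalar matters later, since an \<open>l\<close>-th root of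
  it is divided out.\<close>

lemma quasi_commute_power_mult:
  assumes "b * a = q \<odot> (a * b)" "q \<noteq> 0"
  shows "\<exists>c. c \<noteq> 0 \<and> (a * b) ^ n = c \<odot> (a ^ n * b ^ n)"
proof (induction n)
  case (Suc n)
  then obtain c where c: "c \<noteq> 0" "(a * b) ^ n = c \<odot> (a ^ n * b ^ n)" by blast
  have "(a * b) ^ Suc n = (a * b) ^ n * (a * b)" by (rule power_Suc2)
  also have "\<dots> = c \<odot> (a ^ n * ((b ^ n * a) * b))" using c by (simp add: mult.assoc)
  also have "\<dots> = (c * q ^ n) \<odot> ((a ^ n * a) * (b ^ n * b))"
    using quasi_commute_power_left[OF assms(1)] by (simp add: mult.assoc)
  finally have "(a * b) ^ Suc n = (c * q ^ n) \<odot> (a ^ Suc n * b ^ Suc n)"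
    by (simp add: power_commutes)
  then show ?case using c assms(2) by (intro exI[of _ "c * q ^ n"]) auto
qed (auto intro!: exI[of _ 1])

section \<open>Matrix units, their linear combinations and their span\<close>

definition munits :: "nat \<Rightarrow> (nat \<Rightarrow> nat \<Rightarrow> 'r) \<Rightarrow> bool" where
  "munits N E \<longleftrightarrow>
     (\<forall>i<N. \<forall>j<N. \<forall>k<N. \<forall>m<N. E i j * E k m = (if j = k then E i m else 0)) \<and>
     (\<Sum>i<N. E i i) = 1"

definition lincomb :: "nat \<Rightarrow> (nat \<Rightarrow> nat \<Rightarrow> 'r) \<Rightarrow> (nat \<Rightarrow> nat \<Rightarrow> 'a) \<Rightarrow> 'r" where
  "lincomb N E \<alpha> = (\<Sum>i<N. \<Sum>j<N. \<alpha> i j \<odot> E i j)"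

definition mspan :: "nat \<Rightarrow> (nat \<Rightarrow> nat \<Rightarrow> 'r) \<Rightarrow> 'r set" where
  "mspan N E = range (lincomb N E)"

lemma munitsD:
  assumes "munits N E" "i < N" "j < N" "k < N" "m < N"
  shows "E i j * E k m = (if j = k then E i m else 0)"
  using assms unfolding munits_def by blast

lemma munits_sum: "munits N E \<Longrightarrow> (\<Sum>i<N. E i i) = 1"
  unfolding munits_def by blast

lemma lincomb_cong:
  "(\<And>i j. i < N \<Longrightarrow> j < N \<Longrightarrow> \<alpha> i j = \<beta> i j) \<Longrightarrow> lincomb N E \<alpha> = lincomb N E \<beta>"
  unfolding lincomb_def by (auto intro!: sum.cong)

lemma lincomb_add: "lincomb N E \<alpha> + lincomb N E \<beta> = lincomb N E (\<lambda>i j. \<alpha> i j + \<beta> i j)"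
  unfolding lincomb_def by (simp add: sm_add_left sum.distrib)

lemma lincomb_smult: "c \<odot> lincomb N E \<alpha> = lincomb N E (\<lambda>i j. c * \<alpha> i j)"
  unfolding lincomb_def by (simp add: sm_sum_right)

lemma lincomb_mult:
  assumes "munits N E"
  shows "lincomb N E \<alpha> * lincomb N E \<beta> = lincomb N E (\<lambda>i j. \<Sum>k<N. \<alpha> i k * \<beta> k j)"
proof -
  have inner: "(\<Sum>j<N. \<alpha> i j \<odot> E i j) * (\<Sum>k<N. \<Sum>m<N. \<beta> k m \<odot> E k m)
      = (\<Sum>m<N. \<Sum>j<N. (\<alpha> i j * \<beta> j m) \<odot> E i m)" if i: "i < N" for i
  proof -
    have "(\<Sum>j<N. \<alpha> i j \<odot> E i j) * (\<Sum>k<N. \<Sum>m<N. \<beta> k m \<odot> E k m)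
       = (\<Sum>j<N. \<Sum>k<N. \<Sum>m<N. (\<alpha> i j * \<beta> k m) \<odot> (E i j * E k m))"
      by (simp add: sum_product) (simp add: sum_distrib_left sm_sum_right)
    also have "\<dots> = (\<Sum>j<N. \<Sum>k<N. if k = j then (\<Sum>m<N. (\<alpha> i j * \<beta> k m) \<odot> E i m) else 0)"
      by (intro sum.cong refl) (auto simp: munitsD[OF assms] i)
    also have "\<dots> = (\<Sum>j<N. \<Sum>m<N. (\<alpha> i j * \<beta> j m) \<odot> E i m)"
      by (simp add: sum.delta)
    finally show ?thesis by (subst sum.swap)
  qed
  have "lincomb N E \<alpha> * lincomb N E \<beta> =
     (\<Sum>i<N. (\<Sum>j<N. \<alpha> i j \<odot> E i j) * (\<Sum>k<N. \<Sum>m<N. \<beta> k m \<odot> E k m))"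
    unfolding lincomb_def by (rule sum_distrib_right)
  also have "\<dots> = lincomb N E (\<lambda>i j. \<Sum>k<N. \<alpha> i k * \<beta> k j)"
    unfolding lincomb_def
    by (intro sum.cong refl) (simp add: inner sm_sum_left)
  finally show ?thesis .
qed

lemma lincomb_one: "munits N E \<Longrightarrow> lincomb N E (\<lambda>i j. if i = j then 1 else 0) = 1"
  unfolding lincomb_def
  by (simp add: if_distrib[of "\<lambda>x. x \<odot> _"] sum.delta munits_sum cong: if_cong)

lemma lincomb_unit:
  assumes "a < N" "b < N"
  shows "lincomb N E (\<lambda>i j. if i = a \<and> j = b then 1 else 0) = E a b"
proof -
  have "lincomb N E (\<lambda>i j. if i = a \<and> j = b then 1 else 0) =
     (\<Sum>i<N. if i = a then E i b else 0)"
    unfolding lincomb_def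
    by (intro sum.cong refl) (auto simp: if_distrib[of "\<lambda>x. x \<odot> _"] assms cong: if_cong)
  then show ?thesis using assms by (simp add: sum.delta)
qed

lemma lincomb_inject:
  assumes E: "munits N E" and "(1::'r) \<noteq> 0" and eq: "lincomb N E \<alpha> = lincomb N E \<beta>"
    and ij: "i < N" "j < N"
  shows "\<alpha> i j = \<beta> i j"
proof -
  define \<gamma> where "\<gamma> = (\<lambda>i j. \<alpha> i j + (-1) * \<beta> i j)"
  have 0: "lincomb N E \<gamma> = 0"
  proof -
    have "lincomb N E \<gamma> = lincomb N E \<alpha> + (- 1) \<odot> lincomb N E \<beta>"
      unfolding \<gamma>_def by (simp only: lincomb_add lincomb_smult)
    then show ?thesis unfolding eq by (simp add: sm_uminus)
  qed
  \<comment> \<open>compressing by \<open>E k i\<close> on the left and \<open>E j k\<close> on the right isolates one coefficient\<close>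
  have k: "\<gamma> i j \<odot> E k k = 0" if k: "k < N" for k
  proof -
    have "E k i * lincomb N E \<gamma> * E j k =
        (\<Sum>a<N. \<Sum>b<N. \<gamma> a b \<odot> (E k i * E a b * E j k))"
      unfolding lincomb_def
      by (simp add: sum_distrib_left sum_distrib_right mult.assoc)
    also have "\<dots> = (\<Sum>a<N. if a = i then \<gamma> i j \<odot> E k k else 0)"
      by (intro sum.cong refl)
        (auto simp: munitsD[OF E] ij k if_distrib[of "\<lambda>x. _ \<odot> x"] if_distrib[of "\<lambda>x. x * _"]
           cong: if_cong)
    also have "\<dots> = \<gamma> i j \<odot> E k k" using ij by (simp add: sum.delta)
    finally show ?thesis using 0 by simp
  qed
  \<comment> \<open>Summing over \<open>k\<close> turns the \<open>E k k\<close> into 1, so the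
    coefficient annihilates 1; no single unit has to be known nonzero.\<close>
  have "\<gamma> i j \<odot> 1 = \<gamma> i j \<odot> (\<Sum>k<N. E k k)" using munits_sum[OF E] by simp
  also have "\<dots> = 0" using k by (simp add: sm_sum_right)
  finally have "\<gamma> i j = 0"
    using sm_cancel[of "\<gamma> i j" 1 0] \<open>1 \<noteq> 0\<close> by auto
  then show ?thesis by (simp add: \<gamma>_def)
qed

lemma mspan_add: "x \<in> mspan N E \<Longrightarrow> y \<in> mspan N E \<Longrightarrow> x + y \<in> mspan N E"
  unfolding mspan_def by (auto simp: lincomb_add)

lemma mspan_smult: "x \<in> mspan N E \<Longrightarrow> c \<odot> x \<in> mspan N E"
  unfolding mspan_def by (auto simp: lincomb_smult)

lemma mspan_mult: "munits N E \<Longrightarrow> x \<in> mspan N E \<Longrightarrow> y \<in> mspan N E \<Longrightarrow> x * y \<in> mspan N E"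
  unfolding mspan_def by (auto simp: lincomb_mult)

lemma mspan_one: "munits N E \<Longrightarrow> 1 \<in> mspan N E"
  unfolding mspan_def using lincomb_one[of N E] by (metis rangeI)

lemma mspan_zero: "0 \<in> mspan N E"
proof -
  have "lincomb N E (\<lambda>_ _. 0) = 0" by (simp add: lincomb_def)
  then show ?thesis unfolding mspan_def by (metis rangeI)
qed

lemma mspan_sum: "(\<And>i. i \<in> A \<Longrightarrow> f i \<in> mspan N E) \<Longrightarrow> sum f A \<in> mspan N E"
  by (induction A rule: infinite_finite_induct) (auto intro: mspan_add mspan_zero)

lemma mspan_unit: "a < N \<Longrightarrow> b < N \<Longrightarrow> E a b \<in> mspan N E"
  unfolding mspan_def using lincomb_unit[of a N b E] by (metis rangeI)

end

section \<open>Adjoining a quasi-commuting pair\<close>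

text \<open>The index \<open>c * N + a\<close> encodes the pair \<open>(c, a)\<close>, as for
  Kronecker products; \<open>enlarge\<close> uses this numbering.\<close>

lemma sum_div_mod:
  fixes f :: "nat \<Rightarrow> nat \<Rightarrow> 'b::comm_monoid_add"
  shows "(\<Sum>i<l * N. f (i div N) (i mod N)) = (\<Sum>c<l. \<Sum>a<N. f c a)"
proof (cases "N = 0")
  case False
  have "(\<Sum>c<l. \<Sum>a<N. f c a) = (\<Sum>(c, a)\<in>{..<l} \<times> {..<N}. f c a)"
    by (simp add: sum.cartesian_product)
  also have "\<dots> = (\<Sum>i<l * N. f (i div N) (i mod N))"
  proof (rule sum.reindex_bij_witness[where j = "\<lambda>(c, a). c * N + a" and i = "\<lambda>i. (i div N, i mod N)"])
    fix p assume "p \<in> {..<l} \<times> {..<N}"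
    then obtain c a where p: "p = (c, a)" "c < l" "a < N" by auto
    have "c * N + a < c * N + N" using p by simp
    also have "c * N + N = Suc c * N" by simp
    also have "\<dots> \<le> l * N" using p by (intro mult_le_mono1) simp
    finally show "(case p of (c, a) \<Rightarrow> c * N + a) \<in> {..<l * N}" using p by simp
  next
    fix i assume "i \<in> {..<l * N}"
    then show "(i div N, i mod N) \<in> {..<l} \<times> {..<N}"
      using False by (auto simp: less_mult_imp_div_less)
  qed (use False in auto)
  finally show ?thesis by simp
qed simp

text \<open>\<open>g\<close> and \<open>z\<close> behave like the shift and clock matrices of size
  \<open>l\<close>. The exact order of \<open>\<xi>\<close> separates the eigenvalues of
  \<open>z\<close>, and \<open>l_nonzero\<close> permits averaging over the powers of
  \<open>z\<close>.\<close>

locale quantum_pair = unital_alg sm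
  for sm :: "'a::field \<Rightarrow> 'r::ring_1 \<Rightarrow> 'r" (infixr "\<odot>" 75) +
  fixes l :: nat and \<xi> :: 'a and g z :: 'r
  assumes l_nonzero: "of_nat l \<noteq> (0::'a)"
    and root: "\<xi> ^ l = 1"
    and primitive: "\<And>k. 0 < k \<Longrightarrow> k < l \<Longrightarrow> \<xi> ^ k \<noteq> 1"
    and g_l: "g ^ l = 1" and z_l: "z ^ l = 1"
    and zg: "z * g = \<xi> \<odot> (g * z)"
begin

lemma l_pos: "l > 0"
  using l_nonzero by (cases l) auto

text \<open>Averaging over the cyclic group generated by \<open>z\<close> projects onto the
  eigenvalue 1 of \<open>z\<close>.\<close>

definition P :: 'r where
  "P = inverse (of_nat l) \<odot> (\<Sum>k<l. z ^ k)"

lemma P_commute: "z * y = y * z \<Longrightarrow> P * y = y * P"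
  by (simp add: P_def sum_distrib_left sum_distrib_right power_commuting_commutes)

lemma z_P: "z * P = P"
proof -
  have "z * (\<Sum>k<l. z ^ k) = (\<Sum>k<l. z ^ Suc k)"
    by (simp add: sum_distrib_left)
  also have "\<dots> = (\<Sum>k<Suc l. z ^ k) - z ^ 0"
    by (subst sum.lessThan_Suc_shift) simp
  also have "\<dots> = (\<Sum>k<l. z ^ k)" by (simp add: z_l)
  finally show ?thesis by (simp add: P_def)
qed

lemma P_z: "P * z = P"
  using P_commute[of z] z_P by simp

lemma z_power_P: "z ^ n * P = P"
  by (induction n) (auto simp: mult.assoc z_P)

lemma P_idem: "P * P = P"
proof -
  have "P * P = inverse (of_nat l) \<odot> (\<Sum>k<l. z ^ k * P)"
    by (subst P_def) (simp add: sum_distrib_right)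
  also have "\<dots> = inverse (of_nat l) \<odot> (of_nat l \<odot> P)"
    by (simp only: z_power_P sum_constant card_lessThan sm_of_nat)
  finally show ?thesis using l_nonzero by simp
qed

text \<open>\<open>P\<close> absorbs a factor \<open>z\<close> on either side, while carrying
  \<open>z\<close> across \<open>g ^ k\<close> costs \<open>\<xi> ^ k\<close>; the product therefore
  equals itself times a scalar other than 1.\<close>

lemma P_g_P:
  assumes "\<xi> ^ k \<noteq> 1"
  shows "P * g ^ k * P = 0"
proof -
  have "P * g ^ k * P = P * (z * g ^ k) * P"
    by (metis P_z mult.assoc)
  also have "\<dots> = \<xi> ^ k \<odot> (P * g ^ k * (z * P))"
    by (simp add: quasi_commute_power_right[OF zg] mult.assoc)
  finally have "P * g ^ k * P = \<xi> ^ k \<odot> (P * g ^ k * P)" by (simp add: z_P)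
  then show ?thesis using assms by (rule sm_fixed_eq_zero)
qed

lemma g_power_mod: "g ^ n = g ^ (n mod l)"
proof -
  have "g ^ n = g ^ (l * (n div l) + n mod l)" by simp
  also have "\<dots> = g ^ (n mod l)" by (simp only: power_add power_mult g_l) simp
  finally show ?thesis .
qed

lemma root_power_mod: "\<xi> ^ n = \<xi> ^ (n mod l)"
proof -
  have "\<xi> ^ n = \<xi> ^ (l * (n div l) + n mod l)" by simp
  also have "\<dots> = \<xi> ^ (n mod l)" by (simp only: power_add power_mult root) simp
  finally show ?thesis .
qed

lemma root_power_eq_1: "\<xi> ^ n = 1 \<longleftrightarrow> l dvd n"
proof
  assume "\<xi> ^ n = 1"
  then have "\<not> n mod l > 0" using primitive[of "n mod l"] l_pos root_power_mod[of n] by auto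
  then show "l dvd n" by auto
qed (auto simp: power_mult root)

lemma root_sum:
  assumes "0 < k" "k < l"
  shows "(\<Sum>c<l. \<xi> ^ (k * (l - c))) = 0"
proof -
  \<comment> \<open>Reversing the order of summation turns the factors \<open>l - c\<close> into
    \<open>Suc c\<close>; the resulting geometric series vanishes because
    \<open>(\<xi> ^ k) ^ l = 1\<close>.\<close>
  have "(\<Sum>c<l. \<xi> ^ (k * (l - c))) = (\<Sum>c<l. (\<xi> ^ k) ^ Suc c)"
    by (rule sum.reindex_bij_witness[where i = "\<lambda>c. l - Suc c" and j = "\<lambda>c. l - Suc c"])
      (auto simp: power_mult[symmetric] Suc_diff_Suc)
  also have "\<dots> = \<xi> ^ k * (\<Sum>c<l. (\<xi> ^ k) ^ c)"
    by (simp add: sum_distrib_left)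
  also have "(\<Sum>c<l. (\<xi> ^ k) ^ c) = ((\<xi> ^ k) ^ l - 1) / (\<xi> ^ k - 1)"
    using primitive[OF assms] by (simp add: geometric_sum)
  also have "(\<xi> ^ k) ^ l = (\<xi> ^ l) ^ k" by (simp only: power_mult[symmetric] mult.commute)
  finally show ?thesis by (simp add: root)
qed

text \<open>As \<open>g ^ (l - c)\<close> inverts \<open>g ^ c\<close>, the summands are the
  projections onto the eigenvalues \<open>\<xi> ^ c\<close> of \<open>z\<close>. After expanding
  \<open>P\<close>, the coefficient of \<open>z ^ k\<close> is the character sum of
  \<open>root_sum\<close>, which survives only for \<open>k = 0\<close>.\<close>

lemma sum_conj_P: "(\<Sum>c<l. g ^ c * P * g ^ (l - c)) = 1"
proof -
  have conj: "g ^ c * z ^ k * g ^ (l - c) = \<xi> ^ (k * (l - c)) \<odot> z ^ k" if "c < l" for c k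
  proof -
    have zk: "z ^ k * g = \<xi> ^ k \<odot> (g * z ^ k)" by (rule quasi_commute_power_left[OF zg])
    have "g ^ c * z ^ k * g ^ (l - c) = g ^ c * (z ^ k * g ^ (l - c))" by (simp add: mult.assoc)
    also have "\<dots> = (\<xi> ^ k) ^ (l - c) \<odot> ((g ^ c * g ^ (l - c)) * z ^ k)"
      by (simp add: quasi_commute_power_right[OF zk] mult.assoc)
    also have "g ^ c * g ^ (l - c) = 1" using that by (simp add: power_add[symmetric] g_l)
    finally show ?thesis by (simp add: power_mult)
  qed
  have "(\<Sum>c<l. g ^ c * P * g ^ (l - c))
      = (\<Sum>c<l. inverse (of_nat l) \<odot> (\<Sum>k<l. g ^ c * z ^ k * g ^ (l - c)))"
    by (simp add: P_def sum_distrib_left sum_distrib_right)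
  also have "\<dots> = inverse (of_nat l) \<odot> (\<Sum>c<l. \<Sum>k<l. \<xi> ^ (k * (l - c)) \<odot> z ^ k)"
    by (simp add: conj sm_sum_right)
  also have "(\<Sum>c<l. \<Sum>k<l. \<xi> ^ (k * (l - c)) \<odot> z ^ k) = (\<Sum>k<l. (\<Sum>c<l. \<xi> ^ (k * (l - c))) \<odot> z ^ k)"
    by (subst sum.swap) (simp add: sm_sum_left)
  also have "\<dots> = (\<Sum>k<l. if k = 0 then of_nat l \<odot> 1 else 0)"
    by (intro sum.cong refl) (auto simp: root_sum)
  finally show ?thesis using l_nonzero l_pos by simp
qed

lemma expand: "y = (\<Sum>c<l. y * g ^ c * P * g ^ (l - c))"
proof -
  have "y = y * (\<Sum>c<l. g ^ c * P * g ^ (l - c))" by (simp add: sum_conj_P)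
  then show ?thesis by (simp add: sum_distrib_left mult.assoc)
qed

text \<open>A Kronecker-type product of \<open>E\<close> with the units
  \<open>g ^ c * P * g ^ (l - d)\<close>. In the use below \<open>E\<close> commutes with
  \<open>z\<close> but perhaps not with \<open>g\<close>, hence the powers of \<open>g\<close> stand
  at the two ends.\<close>

definition enlarge :: "nat \<Rightarrow> (nat \<Rightarrow> nat \<Rightarrow> 'r) \<Rightarrow> nat \<Rightarrow> nat \<Rightarrow> 'r" where
  "enlarge N E i j = g ^ (i div N) * E (i mod N) (j mod N) * P * g ^ (l - j div N)"

context
  fixes N :: nat and E :: "nat \<Rightarrow> nat \<Rightarrow> 'r"
  assumes E: "munits N E" and N_pos: "N > 0"
    and z_E: "\<And>i j. i < N \<Longrightarrow> j < N \<Longrightarrow> z * E i j = E i j * z"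
begin

lemma P_E: "i < N \<Longrightarrow> j < N \<Longrightarrow> P * E i j = E i j * P"
  by (simp add: P_commute z_E)

lemma enlarge_mult:
  assumes "i < l * N" "j < l * N" "k < l * N" "m < l * N"
  shows "enlarge N E i j * enlarge N E k m = (if j = k then enlarge N E i m else 0)"
proof -
  have less: "i mod N < N" "j mod N < N" "k mod N < N" "m mod N < N"
      "i div N < l" "j div N < l" "k div N < l" "m div N < l"
    using assms N_pos by (auto simp: less_mult_imp_div_less)
  \<comment> \<open>The difference of the block numbers, shifted by \<open>l\<close> to stay a
    natural number. It lies strictly between 0 and \<open>2 * l\<close>, so \<open>l\<close> divides
    it only if the blocks agree.\<close>
  define e where "e = l - j div N + k div N"
  have prod: "enlarge N E i j * enlarge N E k m =
      g ^ (i div N) * E (i mod N) (j mod N) * (P * g ^ e * P) * E (k mod N) (m mod N) * g ^ (l - m div N)"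
    unfolding enlarge_def e_def
    by (simp add: power_add mult.assoc) (simp only: mult.assoc[symmetric] P_E less)
  show ?thesis
  proof (cases "j div N = k div N")
    case True
    then have "e = l" using less by (simp add: e_def)
    then have "enlarge N E i j * enlarge N E k m =
        g ^ (i div N) * (E (i mod N) (j mod N) * E (k mod N) (m mod N)) * P * g ^ (l - m div N)"
      unfolding prod by (simp add: g_l P_idem) (simp only: mult.assoc P_E less)
    moreover have "j = k \<longleftrightarrow> j mod N = k mod N"
      using True by (metis div_mult_mod_eq)
    ultimately show ?thesis by (simp add: munitsD[OF E] less enlarge_def)
  next
    case False
    have "\<not> l dvd e"
    proof
      assume "l dvd e"
      then obtain q where q: "e = l * q" by blast
      have "0 < e" "e < l * 2" using less by (auto simp: e_def)
      then have "0 < q" "q < 2" unfolding q by auto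
      then have "e = l" using q by (simp add: less_2_cases_iff)
      then show False using False less by (simp add: e_def)
    qed
    then have "P * g ^ e * P = 0" using P_g_P root_power_eq_1 by blast
    then show ?thesis using False unfolding prod by auto
  qed
qed

lemma enlarge_munits: "munits (l * N) (enlarge N E)"
proof -
  have "(\<Sum>i<l * N. enlarge N E i i) = (\<Sum>c<l. \<Sum>a<N. g ^ c * E a a * P * g ^ (l - c))"
    unfolding enlarge_def by (rule sum_div_mod)
  also have "\<dots> = (\<Sum>c<l. g ^ c * (\<Sum>a<N. E a a) * P * g ^ (l - c))"
    by (simp add: sum_distrib_left sum_distrib_right)
  also have "\<dots> = 1" by (simp add: munits_sum[OF E] sum_conj_P)
  finally show ?thesis unfolding munits_def using enlarge_mult by simp
qed

lemma mspan_enlarge_conj: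
  assumes "y \<in> mspan N E" "d < l"
  shows "g ^ c * y * P * g ^ (l - d) \<in> mspan (l * N) (enlarge N E)"
proof -
  \<comment> \<open>A matrix index needs a block number below \<open>l\<close>; \<open>g ^ c\<close>
    depends on \<open>c\<close> only modulo \<open>l\<close>.\<close>
  define c' where "c' = c mod l"
  have c': "c' < l" using l_pos by (simp add: c'_def)
  obtain \<alpha> where y: "y = lincomb N E \<alpha>" using assms(1) by (auto simp: mspan_def)
  have *: "b * N + a < l * N" if "b < l" "a < N" for a b
  proof -
    have "b * N + a < Suc b * N" using that by simp
    also have "\<dots> \<le> l * N" using that by (intro mult_le_mono1) simp
    finally show ?thesis .
  qed
  have "g ^ c * y * P * g ^ (l - d) =
     (\<Sum>a<N. \<Sum>b<N. \<alpha> a b \<odot> enlarge N E (c' * N + a) (d * N + b))"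
    unfolding y lincomb_def enlarge_def g_power_mod[of c] c'_def[symmetric]
    by (simp add: sum_distrib_left sum_distrib_right)
  also have "\<dots> \<in> mspan (l * N) (enlarge N E)"
    by (intro mspan_sum mspan_smult mspan_unit *) (use c' assms(2) in auto)
  finally show ?thesis .
qed

text \<open>Multiplication by \<open>g\<close> shifts the blocks cyclically. The exponent
  \<open>Suc c\<close> reaches \<open>l\<close>, which is why \<open>mspan_enlarge_conj\<close> puts
  no bound on \<open>c\<close>.\<close>

lemma g_mem_mspan: "g \<in> mspan (l * N) (enlarge N E)"
proof -
  have "g = (\<Sum>c<l. g ^ Suc c * 1 * P * g ^ (l - c))" using expand[of g] by simp
  also have "\<dots> \<in> mspan (l * N) (enlarge N E)"
    by (intro mspan_sum mspan_enlarge_conj mspan_one E) simp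
  finally show ?thesis .
qed

text \<open>The earlier generators commute with \<open>g\<close> only up to a scalar. Multiplying
  the resolution of 1 by \<open>y\<close> and carrying \<open>y\<close> across \<open>g ^ c\<close>
  puts it next to \<open>P\<close> at the cost of \<open>\<eta> ^ c\<close>: a block diagonal matrix
  with multiples of \<open>y\<close> as blocks.\<close>

lemma quasi_commuting_mem_mspan:
  assumes "y \<in> mspan N E" "y * g = \<eta> \<odot> (g * y)"
  shows "y \<in> mspan (l * N) (enlarge N E)"
proof -
  have "y = (\<Sum>c<l. \<eta> ^ c \<odot> (g ^ c * y * P * g ^ (l - c)))"
    by (subst expand) (simp add: quasi_commute_power_right[OF assms(2)])
  also have "\<dots> \<in> mspan (l * N) (enlarge N E)"
    by (intro mspan_sum mspan_smult mspan_enlarge_conj assms(1)) simp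
  finally show ?thesis .
qed

text \<open>The spectral decomposition of \<open>z\<close>: on block \<open>c\<close> it is the
  scalar \<open>\<xi> ^ c\<close>.\<close>

lemma z_mem_mspan: "z \<in> mspan (l * N) (enlarge N E)"
proof -
  have "z * g ^ c * P * g ^ (l - c) = \<xi> ^ c \<odot> (g ^ c * 1 * P * g ^ (l - c))" for c
    by (simp add: quasi_commute_power_right[OF zg] mult.assoc z_P)
  then have "z = (\<Sum>c<l. \<xi> ^ c \<odot> (g ^ c * 1 * P * g ^ (l - c)))"
    using expand[of z] by simp
  also have "\<dots> \<in> mspan (l * N) (enlarge N E)"
    by (intro mspan_sum mspan_smult mspan_enlarge_conj mspan_one E) simp
  finally show ?thesis .
qed

end

text \<open>Carries the centraliser clause of \<open>exists_munits\<close> through its induction, so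
  that the next \<open>z\<close> commutes with the enlarged units.\<close>

lemma enlarge_commute:
  assumes "y * g = g * y" "y * z = z * y"
    "\<And>i j. i < N \<Longrightarrow> j < N \<Longrightarrow> y * E i j = E i j * y" "N > 0"
  shows "y * enlarge N E i j = enlarge N E i j * y"
proof -
  have gy: "y * g ^ n = g ^ n * y" for n using assms(1) by (metis power_commuting_commutes)
  have P: "y * P = P * y" using P_commute[of y] assms(2) by simp
  have e: "y * E (i mod N) (j mod N) = E (i mod N) (j mod N) * y" using assms(3,4) by simp
  have "y * enlarge N E i j = g ^ (i div N) * (y * E (i mod N) (j mod N)) * P * g ^ (l - j div N)"
    unfolding enlarge_def by (simp add: mult.assoc[symmetric] gy)
  also have "\<dots> = g ^ (i div N) * E (i mod N) (j mod N) * (y * P) * g ^ (l - j div N)"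
    by (simp add: e mult.assoc)
  also have "\<dots> = enlarge N E i j * y"
    unfolding enlarge_def P by (simp add: mult.assoc gy)
  finally show ?thesis .
qed

end

section \<open>Matrix units from finitely many quasi-commuting generators\<close>

locale clifford_generators = unital_alg sm
  for sm :: "'a::alg_closed_field \<Rightarrow> 'r::ring_1 \<Rightarrow> 'r" (infixr "\<odot>" 75) +
  fixes l :: nat and \<xi> :: 'a and x :: "'i::linorder \<Rightarrow> 'r" and Q :: "'r set"
  assumes l_nonzero: "of_nat l \<noteq> (0::'a)"
    and root: "\<xi> ^ l = 1"
    and primitive: "\<And>k. 0 < k \<Longrightarrow> k < l \<Longrightarrow> \<xi> ^ k \<noteq> 1"
    and x_l: "x i ^ l = 1"
    and x_x: "i < j \<Longrightarrow> x j * x i = \<xi> \<odot> (x i * x j)"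
    and Q_one: "1 \<in> Q" and Q_x: "x i \<in> Q"
    and Q_add: "a \<in> Q \<Longrightarrow> b \<in> Q \<Longrightarrow> a + b \<in> Q"
    and Q_mult: "a \<in> Q \<Longrightarrow> b \<in> Q \<Longrightarrow> a * b \<in> Q"
    and Q_sm: "a \<in> Q \<Longrightarrow> c \<odot> a \<in> Q"
begin

lemma l_pos: "l > 0"
  using l_nonzero by (cases l) auto

lemma root_nonzero: "\<xi> \<noteq> 0"
  using root l_pos by (metis zero_neq_one zero_power)

lemma Q_zero: "0 \<in> Q"
  using Q_sm[OF Q_one, of 0] by simp

lemma Q_sum: "(\<And>i. i \<in> A \<Longrightarrow> f i \<in> Q) \<Longrightarrow> sum f A \<in> Q"
  by (induction A rule: infinite_finite_induct) (auto intro: Q_add Q_zero)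

lemma Q_power: "a \<in> Q \<Longrightarrow> a ^ n \<in> Q"
  by (induction n) (auto intro: Q_one Q_mult)

text \<open>\<open>Q\<close> will consist of the operators that come from the presented algebra;
  units in \<open>Q\<close> thus span a subalgebra of that algebra and not merely of the ambient
  operator ring.\<close>

lemma mspan_subset_Q:
  assumes "\<And>i j. i < N \<Longrightarrow> j < N \<Longrightarrow> E i j \<in> Q"
  shows "mspan N E \<subseteq> Q"
  unfolding mspan_def lincomb_def using assms by (auto intro!: Q_sum Q_sm)

text \<open>Since \<open>x a ^ (l - 1)\<close> inverts \<open>x a\<close>, the factors \<open>\<xi>\<close> picked up from \<open>x r\<close> cancel; the scalar
  \<open>\<zeta>\<close> normalises the \<open>l\<close>-th power to 1.\<close>

lemma exists_partner:
  assumes "a < b"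
  obtains \<zeta> where "\<zeta> \<noteq> 0" "quantum_pair sm l \<xi> (x a) (\<zeta> \<odot> (x a ^ (l - 1) * x b))"
    "\<And>r. b < r \<Longrightarrow> (\<zeta> \<odot> (x a ^ (l - 1) * x b)) * x r = x r * (\<zeta> \<odot> (x a ^ (l - 1) * x b))"
proof -
  define u where "u = x a ^ (l - 1) * x b"
  have ba: "x b * x a = \<xi> \<odot> (x a * x b)" using assms by (rule x_x)
  have "x b * x a ^ (l - 1) = \<xi> ^ (l - 1) \<odot> (x a ^ (l - 1) * x b)"
    by (rule quasi_commute_power_right[OF ba])
  then obtain c where c: "c \<noteq> 0" "u ^ l = c \<odot> ((x a ^ (l - 1)) ^ l * x b ^ l)"
    unfolding u_def using quasi_commute_power_mult[of "x b" "x a ^ (l - 1)" "\<xi> ^ (l - 1)" l]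
      root_nonzero by auto
  have "(x a ^ (l - 1)) ^ l = (x a ^ l) ^ (l - 1)"
    by (simp only: power_mult[symmetric] mult.commute)
  then have ul: "u ^ l = c \<odot> 1" using c by (simp add: x_l)
  obtain \<zeta> where \<zeta>: "\<zeta> ^ l = inverse c"
    using nth_root_exists[of l "inverse c"] l_pos by blast
  have \<zeta>0: "\<zeta> \<noteq> 0" using \<zeta> c l_pos by (metis inverse_zero_imp_zero zero_power)
  have ua: "u * x a = \<xi> \<odot> (x a * u)"
  proof -
    have "u * x a = \<xi> \<odot> ((x a ^ (l - 1) * x a) * x b)"
      unfolding u_def by (simp add: mult.assoc ba)
    also have "x a ^ (l - 1) * x a = x a * x a ^ (l - 1)" by (simp add: power_commutes)
    finally show ?thesis by (simp add: u_def mult.assoc)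
  qed
  have ur: "u * x r = x r * u" if "b < r" for r
  proof -
    have ra: "x r * x a = \<xi> \<odot> (x a * x r)" and rb: "x r * x b = \<xi> \<odot> (x b * x r)"
      using that assms by (auto intro: x_x)
    have "x r * u = (x r * x a ^ (l - 1)) * x b" by (simp add: u_def mult.assoc)
    also have "\<dots> = \<xi> ^ (l - 1) \<odot> (x a ^ (l - 1) * (x r * x b))"
      by (simp add: quasi_commute_power_right[OF ra] mult.assoc)
    also have "\<dots> = (\<xi> ^ (l - 1) * \<xi>) \<odot> (x a ^ (l - 1) * (x b * x r))"
      unfolding rb by simp
    also have "\<xi> ^ (l - 1) * \<xi> = 1" using root l_pos by (metis power_minus_mult)
    finally show ?thesis by (simp add: u_def mult.assoc)
  qed
  have "quantum_pair sm l \<xi> (x a) (\<zeta> \<odot> u)"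
  proof unfold_locales
    show "(\<zeta> \<odot> u) ^ l = 1" by (simp add: sm_power ul \<zeta> c(1))
    show "\<zeta> \<odot> u * x a = \<xi> \<odot> (x a * \<zeta> \<odot> u)" by (simp add: ua mult.commute)
  qed (auto simp: l_nonzero root primitive x_l)
  then show ?thesis using \<zeta>0 ur by (intro that[of \<zeta>]) (auto simp: u_def)
qed

text \<open>The induction splits off two generators at the small end: all others lie above
  \<open>b\<close>, so the partner \<open>z\<close> of \<open>x a\<close> commutes with them. The
  clause about elements \<open>y\<close> transfers this to the units \<open>E\<close>, which is the
  condition for \<open>enlarge\<close>.\<close>

lemma exists_munits:
  assumes "sorted_wrt (<) is" "even (length is)"
  shows "\<exists>E. munits (l ^ (length is div 2)) E \<and>
    (\<forall>i<l ^ (length is div 2). \<forall>j<l ^ (length is div 2). E i j \<in> Q \<and>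
       (\<forall>y. (\<forall>r\<in>set is. y * x r = x r * y) \<longrightarrow> y * E i j = E i j * y)) \<and>
    x ` set is \<subseteq> mspan (l ^ (length is div 2)) E"
  using assms
proof (induction "is" rule: induct_list012)
  case 1
  \<comment> \<open>The empty list gives size \<open>l ^ 0 = 1\<close>, with 1 as the only
    unit.\<close>
  have "munits 1 (\<lambda>_ _. 1)" by (simp add: munits_def)
  then show ?case by (auto intro!: exI[of _ "\<lambda>_ _. 1"] Q_one)
next
  case (3 a b rs)
  define N where "N = l ^ (length rs div 2)"
  have "a < b" and above: "\<And>r. r \<in> set rs \<Longrightarrow> a < r \<and> b < r" and "sorted_wrt (<) rs" "even (length rs)"
    using "3.prems" by auto
  then obtain E where E: "munits N E"
    and E': "\<forall>i<N. \<forall>j<N. E i j \<in> Q \<and>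
       (\<forall>y. (\<forall>r\<in>set rs. y * x r = x r * y) \<longrightarrow> y * E i j = E i j * y)"
    and sp: "x ` set rs \<subseteq> mspan N E"
    using "3.IH"(1) unfolding N_def by meson
  have EQ: "E i j \<in> Q" if "i < N" "j < N" for i j using E' that by blast
  have comm: "y * E i j = E i j * y"
    if "i < N" "j < N" "\<And>r. r \<in> set rs \<Longrightarrow> y * x r = x r * y" for i j y
    using E' that by blast
  have N_pos: "N > 0" using l_pos by (simp add: N_def)
  obtain \<zeta> where \<zeta>: "\<zeta> \<noteq> 0" and qp: "quantum_pair sm l \<xi> (x a) (\<zeta> \<odot> (x a ^ (l - 1) * x b))"
    and zr: "\<And>r. b < r \<Longrightarrow> (\<zeta> \<odot> (x a ^ (l - 1) * x b)) * x r = x r * (\<zeta> \<odot> (x a ^ (l - 1) * x b))"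
    using exists_partner[OF \<open>a < b\<close>] by blast
  define z where "z = \<zeta> \<odot> (x a ^ (l - 1) * x b)"
  interpret quantum_pair sm l \<xi> "x a" z using qp by (simp add: z_def)
  have z_E: "z * E i j = E i j * z" if "i < N" "j < N" for i j
    by (rule comm[OF that]) (use zr above in \<open>auto simp only: z_def\<close>)
  let ?E = "enlarge N E"
  have mu: "munits (l * N) ?E" by (rule enlarge_munits[OF E N_pos z_E])
  have "z \<in> Q" unfolding z_def by (intro Q_sm Q_mult Q_power Q_x)
  then have "P \<in> Q" unfolding P_def by (intro Q_sm Q_sum Q_power)
  then have inQ: "?E i j \<in> Q" for i j
    unfolding enlarge_def using N_pos by (intro Q_mult Q_power Q_x EQ) auto
  have comm': "y * ?E i j = ?E i j * y" if y: "\<And>r. r \<in> set (a # b # rs) \<Longrightarrow> y * x r = x r * y" for y i j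
  proof (rule enlarge_commute)
    show ya: "y * x a = x a * y" using y by simp
    have "y * x a ^ (l - 1) = x a ^ (l - 1) * y" using ya by (metis power_commuting_commutes)
    then have "y * (x a ^ (l - 1) * x b) = (x a ^ (l - 1) * x b) * y"
      using y by (simp add: mult.assoc[symmetric]) (simp add: mult.assoc)
    then show "y * z = z * y" by (simp add: z_def)
    show "y * E i j = E i j * y" if "i < N" "j < N" for i j using comm that y by simp
  qed (rule N_pos)
  have xa: "x a \<in> mspan (l * N) ?E" by (rule g_mem_mspan[OF E N_pos z_E])
  have xz: "z \<in> mspan (l * N) ?E" by (rule z_mem_mspan[OF E N_pos z_E])
  \<comment> \<open>\<open>x a ^ (l - 1)\<close> is the inverse of \<open>x a\<close>, so
    \<open>x b\<close> can be recovered from \<open>z\<close>.\<close>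
  have "x b = inverse \<zeta> \<odot> (x a * z)"
  proof -
    have "x a * x a ^ (l - 1) = 1" using x_l[of a] l_pos by (metis power_minus_mult power_commutes)
    then show ?thesis using \<zeta> by (simp add: z_def mult.assoc[symmetric])
  qed
  then have xb: "x b \<in> mspan (l * N) ?E" using mspan_smult mspan_mult[OF mu xa xz] by metis
  have xr: "x r \<in> mspan (l * N) ?E" if "r \<in> set rs" for r
  proof (rule quasi_commuting_mem_mspan[OF E N_pos z_E])
    show "x r \<in> mspan N E" using sp that by auto
    show "x r * x a = \<xi> \<odot> (x a * x r)" using above[OF that] by (intro x_x) simp
  qed
  have len: "l ^ (length (a # b # rs) div 2) = l * N" by (simp add: N_def)
  show ?case unfolding len
  proof (intro exI[of _ ?E] conjI allI impI)
    show "x ` set (a # b # rs) \<subseteq> mspan (l * N) ?E" using xa xb xr by auto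
    show "y * ?E i j = ?E i j * y" if "\<forall>r\<in>set (a # b # rs). y * x r = x r * y" for i j y
      using that by (intro comm') blast
  qed (rule mu inQ)+
\<comment> \<open>The one-element list is excluded by parity.\<close>
qed auto

end

section \<open>Unital homomorphisms between matrix algebras\<close>

text \<open>Over a finite field, 1 plus the product of all \<open>[:- a, 1:]\<close> takes the value
  1 everywhere, although its positive degree would force a root.\<close>

lemma alg_closed_infinite: "infinite (UNIV :: 'a::alg_closed_field set)"
proof
  assume fin: "finite (UNIV :: 'a set)"
  define p :: "'a poly" where "p = (\<Prod>a\<in>UNIV. [:- a, 1:]) + 1"
  have deg: "degree (\<Prod>a\<in>(UNIV :: 'a set). [:- a, 1:]) = card (UNIV :: 'a set)"
    by (subst degree_prod_eq_sum_degree) auto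
  have "card (UNIV :: 'a set) > 0" using fin by (simp add: card_gt_0_iff)
  then have "degree p > 0" unfolding p_def using deg by (subst degree_add_eq_left) auto
  then obtain a where "poly p a = 0" using alg_closed_imp_poly_has_root by blast
  moreover have "poly p a = 1"
    unfolding p_def using fin by (simp add: poly_prod prod_zero_iff)
  ultimately show False by simp
qed

definition dmat :: "nat \<Rightarrow> (nat \<Rightarrow> 'a::semiring_1) \<Rightarrow> 'a mat" where
  "dmat n f = mat n n (\<lambda>(i, j). if i = j then f i else 0)"

lemma dmat_carrier [simp]: "dmat n f \<in> carrier_mat n n"
  by (simp add: dmat_def)

lemma dmat_mult_left:
  assumes "A \<in> carrier_mat n n"
  shows "dmat n f * A = mat n n (\<lambda>(i, j). f i * A $$ (i, j))"
  using assms by (intro eq_matI)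
    (auto simp: dmat_def scalar_prod_def if_distrib[of "\<lambda>x. x * _"] sum.delta cong: if_cong)

lemma dmat_mult_right:
  assumes "A \<in> carrier_mat n n"
  shows "A * dmat n f = mat n n (\<lambda>(i, j). A $$ (i, j) * f j)"
  using assms by (intro eq_matI)
    (auto simp: dmat_def scalar_prod_def if_distrib[of "\<lambda>x. _ * x"] sum.delta cong: if_cong)

text \<open>The determinant of \<open>\<psi> (diag(t,1,\<dots>,1))\<close> is a polynomial in \<open>t\<close> whose \<open>n\<close>-th power is
  \<open>det (\<psi> (t I)) = t\<^sup>N\<close>: the \<open>n\<close> coordinate dilations are conjugate and multiply to \<open>t I\<close>.\<close>

lemma matrix_hom_dvd:
  fixes \<psi> :: "'a::alg_closed_field mat \<Rightarrow> 'a mat"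
  assumes n: "n > 0"
    and car: "\<And>A. A \<in> carrier_mat n n \<Longrightarrow> \<psi> A \<in> carrier_mat N N"
    and one: "\<psi> (1\<^sub>m n) = 1\<^sub>m N"
    and add: "\<And>A B. A \<in> carrier_mat n n \<Longrightarrow> B \<in> carrier_mat n n \<Longrightarrow> \<psi> (A + B) = \<psi> A + \<psi> B"
    and mul: "\<And>A B. A \<in> carrier_mat n n \<Longrightarrow> B \<in> carrier_mat n n \<Longrightarrow> \<psi> (A * B) = \<psi> A * \<psi> B"
    and smul: "\<And>c A. A \<in> carrier_mat n n \<Longrightarrow> \<psi> (c \<cdot>\<^sub>m A) = c \<cdot>\<^sub>m \<psi> A"
  shows "n dvd N"
proof -
  define U :: "nat \<Rightarrow> 'a \<Rightarrow> 'a mat" where "U = (\<lambda>k t. dmat n (\<lambda>i. if i = k then t else 1))"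
  define V :: "nat \<Rightarrow> 'a \<Rightarrow> 'a mat" where "V = (\<lambda>k t. dmat n (\<lambda>i. if i < k then t else 1))"
  have UV [simp]: "U k t \<in> carrier_mat n n" "V k t \<in> carrier_mat n n" for k t
    by (auto simp: U_def V_def)
  have detmul: "det (\<psi> (A * B)) = det (\<psi> A) * det (\<psi> B)"
    if "A \<in> carrier_mat n n" "B \<in> carrier_mat n n" for A B
    using that by (simp add: mul det_mult[OF car car])
  have detU: "det (\<psi> (U k t)) = det (\<psi> (U 0 t))" if k: "k < n" for k t
  proof -
    \<comment> \<open>The transposition of 0 and \<open>k\<close>. Its permutation matrix
      \<open>S\<close> is an involution, so \<open>det (\<psi> S)\<close> is nonzero, and it
      conjugates \<open>U 0 t\<close> into \<open>U k t\<close>.\<close>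
    define \<sigma> where "\<sigma> = (\<lambda>i. if i = 0 then k else if i = k then 0 else i)"
    define S :: "'a mat" where "S = mat n n (\<lambda>(i, j). if j = \<sigma> i then 1 else 0)"
    have S: "S \<in> carrier_mat n n" by (simp add: S_def)
    have \<sigma>: "\<sigma> i < n" "\<sigma> (\<sigma> i) = i" if "i < n" for i using that n k by (auto simp: \<sigma>_def)
    have "S * S = 1\<^sub>m n"
      by (rule eq_matI)
        (auto simp: S_def scalar_prod_def \<sigma> if_distrib[of "\<lambda>x. x * _"] sum.delta cong: if_cong)
    then have "det (\<psi> S) * det (\<psi> S) = 1" using detmul[OF S S] one by simp
    then have nz: "det (\<psi> S) \<noteq> 0" by auto
    have "U k t * S = S * U 0 t"
      unfolding U_def dmat_mult_left[OF S] dmat_mult_right[OF S]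
      by (rule eq_matI) (auto simp: S_def \<sigma>_def)
    then show ?thesis using detmul[OF UV(1) S] detmul[OF S UV(1)] nz by (metis mult.commute mult_left_cancel)
  qed
  have detV: "det (\<psi> (V k t)) = det (\<psi> (U 0 t)) ^ k" if "k \<le> n" for k t
    using that
  proof (induction k)
    case 0
    have "V 0 t = 1\<^sub>m n" by (rule eq_matI) (auto simp: V_def dmat_def)
    then show ?case by (simp add: one)
  next
    case (Suc k)
    have "V (Suc k) t = V k t * U k t"
      unfolding V_def dmat_mult_left[OF UV(1)]
      by (rule eq_matI) (auto simp: U_def dmat_def)
    then show ?case using Suc detU[of k t] by (simp add: detmul)
  qed
  have "V n t = t \<cdot>\<^sub>m 1\<^sub>m n" for t by (rule eq_matI) (auto simp: V_def dmat_def)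
  then have key: "det (\<psi> (U 0 t)) ^ n = t ^ N" for t
    using detV[of n t] by (simp add: smul one)
  define e where "e = dmat n (\<lambda>i. if i = 0 then 1 else (0::'a))"
  define M where "M = \<psi> e"
  have M: "M \<in> carrier_mat N N" unfolding M_def by (rule car) (simp add: e_def)
  \<comment> \<open>The entries are linear polynomials whose values at \<open>t\<close> form the
    matrix 1 + (t - 1) \<open>M\<close>, the image of \<open>U 0 t\<close> under
    \<open>\<psi>\<close>; the determinant becomes a polynomial with a degree.\<close>
  define D :: "'a poly" where
    "D = det (mat N N (\<lambda>(i, j). [:(if i = j then 1 else 0) - M $$ (i, j), M $$ (i, j):]))"
  have D: "poly D t = det (\<psi> (U 0 t))" for t
  proof -
    have "U 0 t = 1\<^sub>m n + (t - 1) \<cdot>\<^sub>m e" by (rule eq_matI) (auto simp: U_def e_def dmat_def)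
    then have eq: "\<psi> (U 0 t) = 1\<^sub>m N + (t - 1) \<cdot>\<^sub>m M"
      by (simp add: add smul one M_def e_def)
    show ?thesis unfolding eq D_def
      by (subst (1 2) det_def'[of _ N])
        (use M in \<open>auto simp: poly_sum poly_prod sign_def algebra_simps permutes_in_image
           intro!: sum.cong prod.cong\<close>)
  qed
  \<comment> \<open>Both sides take the same value at every point of an infinite field.\<close>
  have "D ^ n = monom 1 N"
  proof (rule ccontr)
    assume "D ^ n \<noteq> monom 1 N"
    then have "finite {t. poly (D ^ n - monom 1 N) t = 0}" by (intro poly_roots_finite) simp
    moreover have "{t. poly (D ^ n - monom 1 N) t = 0} = UNIV"
      by (auto simp: poly_monom D key)
    ultimately show False using alg_closed_infinite[where 'a = 'a] by simp
  qed
  then have "degree (D ^ n) = N" by (simp add: degree_monom_eq)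
  moreover have "D \<noteq> 0" using \<open>D ^ n = monom 1 N\<close> n by (auto simp: zero_power)
  ultimately show ?thesis by (metis degree_power_eq dvd_triv_left)
qed

section \<open>Inclusions between unital matrix subalgebras\<close>

lemma matrix_subalgebra_dvd:
  fixes A :: "('a::alg_closed_field, 'b) falg"
  assumes "n > 0" "matrix_subalgebra A n B" "matrix_subalgebra A N C" "B \<subseteq> C"
  shows "n dvd N"
proof -
  obtain \<phi> where \<phi>: "bij_betw \<phi> (carrier_mat n n :: 'a mat set) B" "\<phi> (1\<^sub>m n) = aone A"
    "\<And>a b. a \<in> carrier_mat n n \<Longrightarrow> b \<in> carrier_mat n n \<Longrightarrow> \<phi> (a + b) = aadd A (\<phi> a) (\<phi> b)"
    "\<And>a b. a \<in> carrier_mat n n \<Longrightarrow> b \<in> carrier_mat n n \<Longrightarrow> \<phi> (a * b) = amul A (\<phi> a) (\<phi> b)"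
    "\<And>c a. a \<in> carrier_mat n n \<Longrightarrow> \<phi> (c \<cdot>\<^sub>m a) = asmul A c (\<phi> a)"
    using assms(2) unfolding matrix_subalgebra_def by blast
  obtain \<theta> where \<theta>: "bij_betw \<theta> (carrier_mat N N :: 'a mat set) C" "\<theta> (1\<^sub>m N) = aone A"
    "\<And>a b. a \<in> carrier_mat N N \<Longrightarrow> b \<in> carrier_mat N N \<Longrightarrow> \<theta> (a + b) = aadd A (\<theta> a) (\<theta> b)"
    "\<And>a b. a \<in> carrier_mat N N \<Longrightarrow> b \<in> carrier_mat N N \<Longrightarrow> \<theta> (a * b) = amul A (\<theta> a) (\<theta> b)"
    "\<And>c a. a \<in> carrier_mat N N \<Longrightarrow> \<theta> (c \<cdot>\<^sub>m a) = asmul A c (\<theta> a)"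
    using assms(3) unfolding matrix_subalgebra_def by blast
  \<comment> \<open>The matrix in \<open>C\<close> of an element of \<open>B\<close>. Both
    isomorphisms send the identity matrix to \<open>aone A\<close>, so this is a unital homomorphism
    from size \<open>n\<close> to size \<open>N\<close>.\<close>
  define \<psi> where "\<psi> = (\<lambda>a. inv_into (carrier_mat N N) \<theta> (\<phi> a))"
  have mem: "\<phi> a \<in> \<theta> ` carrier_mat N N" if "a \<in> carrier_mat n n" for a
    using \<phi>(1) \<theta>(1) that assms(4) unfolding bij_betw_def by blast
  have car: "\<psi> a \<in> carrier_mat N N" and \<theta>\<psi>: "\<theta> (\<psi> a) = \<phi> a" if "a \<in> carrier_mat n n" for a
    using mem[OF that] unfolding \<psi>_def by (auto intro: inv_into_into f_inv_into_f)
  have eqI: "\<psi> a = b" if "a \<in> carrier_mat n n" "b \<in> carrier_mat N N" "\<phi> a = \<theta> b" for a b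
    using \<theta>(1) car[OF that(1)] \<theta>\<psi>[OF that(1)] that unfolding bij_betw_def by (metis inj_onD)
  show ?thesis
  proof (rule matrix_hom_dvd[of n \<psi> N])
    show "\<psi> (1\<^sub>m n) = 1\<^sub>m N" by (rule eqI) (auto simp: \<phi> \<theta>)
    show "\<psi> (a + b) = \<psi> a + \<psi> b" if "a \<in> carrier_mat n n" "b \<in> carrier_mat n n" for a b
      using that by (intro eqI) (auto simp: \<phi> \<theta> car \<theta>\<psi>)
    show "\<psi> (a * b) = \<psi> a * \<psi> b" if "a \<in> carrier_mat n n" "b \<in> carrier_mat n n" for a b
      using that car[OF that(1)] car[OF that(2)] by (intro eqI) (auto simp: \<phi> \<theta> \<theta>\<psi>)
    show "\<psi> (c \<cdot>\<^sub>m a) = c \<cdot>\<^sub>m \<psi> a" if "a \<in> carrier_mat n n" for a c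
      using that by (intro eqI) (auto simp: \<phi> \<theta> car \<theta>\<psi>)
  qed (use assms(1) car in auto)
qed

text \<open>The images of the matrix units span \<open>B\<close> linearly. A subalgebra provided by
  local matricity thus absorbs all of \<open>B\<close> once it absorbs finitely many
  elements.\<close>

lemma matrix_subalgebra_finitely_generated:
  assumes "matrix_subalgebra A n B"
  obtains X where "finite X" "X \<subseteq> B" "\<And>C. subalgebra A C \<Longrightarrow> X \<subseteq> C \<Longrightarrow> B \<subseteq> C"
proof -
  obtain \<phi> where \<phi>: "bij_betw \<phi> (carrier_mat n n :: 'a mat set) B"
    "\<And>a b. a \<in> carrier_mat n n \<Longrightarrow> b \<in> carrier_mat n n \<Longrightarrow> \<phi> (a + b) = aadd A (\<phi> a) (\<phi> b)"
    "\<And>c a. a \<in> carrier_mat n n \<Longrightarrow> \<phi> (c \<cdot>\<^sub>m a) = asmul A c (\<phi> a)"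
    using assms unfolding matrix_subalgebra_def by blast
  define u :: "nat \<times> nat \<Rightarrow> 'a mat" where "u = (\<lambda>p. mat n n (\<lambda>q. if q = p then 1 else 0))"
  \<comment> \<open>The image of the zero matrix starts the induction over the positions; nothing
    here identifies it with \<open>azero A\<close>.\<close>
  define X where "X = insert (\<phi> (0\<^sub>m n n)) ((\<lambda>p. \<phi> (u p)) ` ({..<n} \<times> {..<n}))"
  have "B \<subseteq> C" if C: "subalgebra A C" "X \<subseteq> C" for C
  proof
    fix b assume "b \<in> B"
    then obtain M where M: "M \<in> carrier_mat n n" "b = \<phi> M" using \<phi>(1) unfolding bij_betw_def by blast
    have "\<phi> (mat n n (\<lambda>q. if q \<in> S then M $$ q else 0)) \<in> C"
      if "finite S" "S \<subseteq> {..<n} \<times> {..<n}" for S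
      using that
    proof (induction S rule: finite_induct)
      case empty
      have "mat n n (\<lambda>q. if q \<in> {} then M $$ q else 0) = 0\<^sub>m n n" by (rule eq_matI) auto
      then show ?case using C by (simp add: X_def)
    next
      case (insert p S)
      have "mat n n (\<lambda>q. if q \<in> insert p S then M $$ q else 0)
          = M $$ p \<cdot>\<^sub>m u p + mat n n (\<lambda>q. if q \<in> S then M $$ q else 0)"
        using insert by (intro eq_matI) (auto simp: u_def)
      moreover have "\<phi> (u p) \<in> C" using C insert by (auto simp: X_def)
      moreover have "u p \<in> carrier_mat n n" by (simp add: u_def)
      ultimately show ?case using C insert by (auto simp: \<phi> subalgebra_def)
    qed
    from this[of "{..<n} \<times> {..<n}"]
    have "\<phi> (mat n n (\<lambda>q. if q \<in> {..<n} \<times> {..<n} then M $$ q else 0)) \<in> C" by simp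
    moreover have "mat n n (\<lambda>q. if q \<in> {..<n} \<times> {..<n} then M $$ q else 0) = M"
      using M by (intro eq_matI) auto
    ultimately show "b \<in> C" using M by simp
  qed
  moreover have "X \<subseteq> B" using \<phi>(1) unfolding X_def bij_betw_def u_def by auto
  ultimately show ?thesis using that[of X] by (simp add: X_def)
qed

section \<open>The operator model\<close>

text \<open>Linear endomorphisms of the space of all functions on \<open>'m\<close>, made a type so
  that composition gives an instance of \<open>ring_1\<close>.\<close>

typedef (overloaded) ('m, 'a) lop =
  "{T :: ('m \<Rightarrow> 'a::field) \<Rightarrow> 'm \<Rightarrow> 'a.
     (\<forall>f g. T (\<lambda>m. f m + g m) = (\<lambda>m. T f m + T g m)) \<and> (\<forall>c f. T (\<lambda>m. c * f m) = (\<lambda>m. c * T f m))}"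
  morphisms app Lop
  by (rule exI[of _ "\<lambda>f. f"]) simp

setup_lifting type_definition_lop

lemma app_scale: "app T (\<lambda>m. c * f m) = (\<lambda>m. c * app T f m)"
  using app[of T] by auto

instantiation lop :: (type, field) ring_1
begin

lift_definition zero_lop :: "('a, 'b) lop" is "\<lambda>f m. 0" by simp
lift_definition one_lop :: "('a, 'b) lop" is "\<lambda>f. f" by simp
lift_definition plus_lop :: "('a, 'b) lop \<Rightarrow> ('a, 'b) lop \<Rightarrow> ('a, 'b) lop" is "\<lambda>S T f m. S f m + T f m"
  by (simp add: algebra_simps)
lift_definition uminus_lop :: "('a, 'b) lop \<Rightarrow> ('a, 'b) lop" is "\<lambda>S f m. - S f m"
  by simp
lift_definition minus_lop :: "('a, 'b) lop \<Rightarrow> ('a, 'b) lop \<Rightarrow> ('a, 'b) lop" is "\<lambda>S T f m. S f m - T f m"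
  by (simp add: algebra_simps)
lift_definition times_lop :: "('a, 'b) lop \<Rightarrow> ('a, 'b) lop \<Rightarrow> ('a, 'b) lop" is "\<lambda>S T f. S (T f)"
  by simp

instance
proof
  show "(0::('a, 'b) lop) \<noteq> 1"
  proof (transfer, rule notI)
    assume "(\<lambda>f m. 0) = (\<lambda>f::'a \<Rightarrow> 'b. f)"
    from fun_cong[OF fun_cong[OF this, of "\<lambda>_. 1"]] show False by simp
  qed
qed (transfer; simp add: algebra_simps)+

end

lift_definition scale_lop :: "'a::field \<Rightarrow> ('m, 'a) lop \<Rightarrow> ('m, 'a) lop" is "\<lambda>c T f m. c * T f m"
  by (simp add: algebra_simps)

lemma lop_eqI: "(\<And>f m. app S f m = app T f m) \<Longrightarrow> S = T"
  by (metis app_inject ext)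

lemma app_simps [simp]:
  "app 0 f m = 0" "app 1 f = f" "app (S + T) f m = app S f m + app T f m"
  "app (S * T) f = app S (app T f)" "app (scale_lop c T) f = (\<lambda>m. c * app T f m)"
  by (transfer; simp)+

lemma app_sum: "app (sum F A) f m = (\<Sum>i\<in>A. app (F i) f m)"
  by (induction A rule: infinite_finite_induct) auto

interpretation lop: unital_alg "scale_lop :: 'a::field \<Rightarrow> ('m, 'a) lop \<Rightarrow> ('m, 'a) lop"
  by unfold_locales (auto intro!: lop_eqI simp: algebra_simps app_scale)

text \<open>The \<open>i\<close>-th coordinate is rotated inside its block \<open>{q l, \<dots>, q l + l - 1}\<close>, so that the
  rotation has order \<open>l\<close> on all multisets, not only on those with multiplicities below \<open>l\<close>.\<close>

definition rot :: "nat \<Rightarrow> nat \<Rightarrow> nat" where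
  "rot l k = k div l * l + Suc k mod l"

definition next_mset :: "nat \<Rightarrow> 'i \<Rightarrow> 'i multiset \<Rightarrow> 'i multiset" where
  "next_mset l i m = filter_mset (\<lambda>j. j \<noteq> i) m + replicate_mset (rot l (count m i)) i"

lemma rot_power: "l > 0 \<Longrightarrow> (rot l ^^ n) k = k div l * l + (k + n) mod l"
  by (induction n) (auto simp: rot_def mod_Suc_eq)

lemma rot_order: "l > 0 \<Longrightarrow> (rot l ^^ l) k = k"
  by (simp add: rot_power)

lemma count_next_mset: "count (next_mset l i m) j = (if j = i then rot l (count m i) else count m j)"
  by (auto simp: next_mset_def)

lemma next_mset_commute: "next_mset l i (next_mset l j m) = next_mset l j (next_mset l i m)"
  by (rule multiset_eqI) (simp add: count_next_mset)

lemma count_next_mset_power: 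
  "count ((next_mset l i ^^ n) m) j = (if j = i then (rot l ^^ n) (count m i) else count m j)"
  by (induction n) (auto simp: count_next_mset)

lemma next_mset_order: "l > 0 \<Longrightarrow> (next_mset l i ^^ l) m = m"
  by (rule multiset_eqI) (simp add: count_next_mset_power rot_order)

lemma next_mset_eq: "Suc (count m i) < l \<Longrightarrow> next_mset l i m = add_mset i m"
  by (rule multiset_eqI) (auto simp: count_next_mset rot_def dest: Suc_lessD)

text \<open>The exponent of the phase, as in a Jordan-Wigner representation: \<open>x_i\<close> sees
  only the larger indices. Multisets are finite, so the exponent makes sense for an infinite index
  set.\<close>

definition count_above :: "'i::linorder \<Rightarrow> 'i multiset \<Rightarrow> nat" where
  "count_above i m = size (filter_mset (\<lambda>j. i < j) m)"

lemma filter_replicate_mset: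
  "filter_mset Q (replicate_mset n a) = (if Q a then replicate_mset n a else {#})"
  by (rule multiset_eqI) auto

text \<open>The additive form is chosen because a rotation can lower a multiplicity and subtraction
  of naturals truncates.\<close>

lemma count_above_next_mset: 
  "count_above i (next_mset l j m) + (if i < j then count m j else 0) =
   count_above i m + (if i < j then rot l (count m j) else 0)"
proof -
  have "filter_mset (\<lambda>k. i < k) m =
      filter_mset (\<lambda>k. i < k) (filter_mset (\<lambda>k. k \<noteq> j) m + replicate_mset (count m j) j)"
    by (rule arg_cong[of _ _ "filter_mset _"], rule multiset_eqI) auto
  then show ?thesis unfolding count_above_def next_mset_def by (simp add: filter_replicate_mset)
qed

text \<open>The shift acts by precomposition, so in a product of operators the first letter moves
  the multiset first.\<close>

lift_definition clg_op :: "nat \<Rightarrow> 'a::field \<Rightarrow> 'i::linorder \<Rightarrow> ('i multiset, 'a) lop" is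
  "\<lambda>l \<xi> i f m. \<xi> ^ count_above i m * f (next_mset l i m)"
  by (simp add: algebra_simps)

lemma app_clg_op [simp]: "app (clg_op l \<xi> i) f m = \<xi> ^ count_above i m * f (next_mset l i m)"
  by transfer simp

lemma clg_op_order:
  assumes "\<xi> ^ l = 1" "l > 0"
  shows "clg_op l \<xi> i ^ l = 1"
proof (rule lop_eqI)
  fix f m
  have ab: "count_above i (next_mset l i m) = count_above i m" for m
    using count_above_next_mset[of i l i m] by simp
  have "app (clg_op l \<xi> i ^ n) f m = \<xi> ^ (n * count_above i m) * f ((next_mset l i ^^ n) m)" for n m
    by (induction n arbitrary: m) (auto simp: ab power_add funpow_swap1)
  from this[of l m] show "app (clg_op l \<xi> i ^ l) f m = app 1 f m"
    using assms by (simp add: next_mset_order power_mult)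
qed

lemma root_power_cong:
  fixes \<xi> :: "'a::field"
  assumes "\<xi> ^ l = 1" "a mod l = b mod l"
  shows "\<xi> ^ a = \<xi> ^ b"
proof -
  have "\<xi> ^ n = \<xi> ^ (n mod l)" for n
  proof -
    have "\<xi> ^ n = \<xi> ^ (l * (n div l) + n mod l)" by simp
    also have "\<dots> = \<xi> ^ (n mod l)" by (simp only: power_add power_mult assms) simp
    finally show ?thesis .
  qed
  then show ?thesis using assms(2) by metis
qed

lemma clg_op_commute:
  assumes root: "\<xi> ^ l = 1" "l > 0" and "i < j"
  shows "clg_op l \<xi> j * clg_op l \<xi> i = scale_lop \<xi> (clg_op l \<xi> i * clg_op l \<xi> j)"
proof (rule lop_eqI)
  fix f m
  have "count_above j (next_mset l i m) = count_above j m"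
    using count_above_next_mset[of j l i m] \<open>i < j\<close> by (simp add: less_not_sym)
  \<comment> \<open>Shifting \<open>j\<close> raises its multiplicity by 1 modulo \<open>l\<close>,
    and \<open>x_i\<close> counts \<open>j\<close>; this yields the extra \<open>\<xi>\<close>,
    whereas the shift of \<open>i\<close> is invisible to \<open>x_j\<close>.\<close>
  moreover have "\<xi> ^ count_above i (next_mset l j m) = \<xi> * \<xi> ^ count_above i m"
  proof -
    define k where "k = count m j"
    define A where "A = count_above i (next_mset l j m)"
    have "A + k = count_above i m + rot l k"
      using count_above_next_mset[of i l j m] \<open>i < j\<close> by (simp add: A_def k_def)
    then have "\<xi> ^ (A + k) = \<xi> ^ (count_above i m + rot l k)" by simp
    also have "\<dots> = \<xi> ^ (Suc (count_above i m) + k)"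
    proof (rule root_power_cong[OF root(1)])
      have "rot l k mod l = Suc k mod l" by (simp add: rot_def)
      then show "(count_above i m + rot l k) mod l = (Suc (count_above i m) + k) mod l"
        by (metis mod_add_right_eq add_Suc_shift)
    qed
    finally have "\<xi> ^ A * \<xi> ^ k = (\<xi> * \<xi> ^ count_above i m) * \<xi> ^ k" by (simp add: power_add)
    moreover have "\<xi> \<noteq> 0" using root by (metis zero_power zero_neq_one)
    ultimately show ?thesis by (simp add: A_def)
  qed
  ultimately show "app (clg_op l \<xi> j * clg_op l \<xi> i) f m = app (scale_lop \<xi> (clg_op l \<xi> i * clg_op l \<xi> j)) f m"
    by (simp add: next_mset_commute)
qed

section \<open>The free algebra and its evaluations\<close>

definition mono_word :: "'i list \<Rightarrow> 'i list \<Rightarrow> 'a::field" where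
  "mono_word w = (\<lambda>v. if v = w then 1 else 0)"

lemma free_one_eq: "free_one = mono_word []"
  and free_gen_eq: "free_gen i = mono_word [i]"
  by (simp_all add: free_one_def free_gen_def mono_word_def)

lemma free_diff_eq: "free_diff f g = free_add f (free_smul (- 1) g)"
  by (simp add: free_diff_def free_add_def free_smul_def)

lemma free_mult_mono_word: "free_mult (mono_word u) (mono_word v) = (mono_word (u @ v) :: _ \<Rightarrow> 'a::field)"
proof
  fix w
  have "free_mult (mono_word u) (mono_word v) w =
      (\<Sum>k\<le>length w. if k = length u then (if w = u @ v then 1 else 0) else (0::'a))"
    unfolding free_mult_def mono_word_def
  proof (intro sum.cong refl)
    fix k assume "k \<in> {..length w}"
    then have "length (take k w) = k" by simp
    then have "take k w = u \<and> drop k w = v \<longleftrightarrow> k = length u \<and> w = u @ v"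
      by (metis append_take_drop_id append_eq_conv_conj)
    then show "(if take k w = u then 1 else 0) * (if drop k w = v then 1 else 0) =
        (if k = length u then if w = u @ v then 1 else 0 else (0::'a))"
      by (cases "take k w = u"; cases "drop k w = v"; cases "k = length u"; cases "w = u @ v";
        simp only: simp_thms if_True if_False mult_1 mult_zero_left mult_zero_right)
  qed
  also have "\<dots> = mono_word (u @ v) w" by (auto simp: mono_word_def)
  finally show "free_mult (mono_word u) (mono_word v) w = (mono_word (u @ v) w :: 'a)" .
qed

lemma free_pow_gen: "free_pow (free_gen i) n = mono_word (replicate n i)"
  by (induction n) (simp_all add: free_one_eq free_gen_eq free_mult_mono_word replicate_append_same)

lemma free_mult_linear:
  "free_mult f (free_add g h) = free_add (free_mult f g) (free_mult f h)"
  "free_mult (free_add g h) f = free_add (free_mult g f) (free_mult h f)"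
  "free_mult f (free_smul c g) = free_smul c (free_mult f g)"
  "free_mult (free_smul c g) f = free_smul c (free_mult g f)"
  by (auto simp: fun_eq_iff free_mult_def free_add_def free_smul_def algebra_simps sum.distrib sum_distrib_left)

lemma mono_word_free_alg [simp]: "mono_word w \<in> free_alg"
  by (simp add: mono_word_def free_alg_def)

lemma free_add_free_alg: "f \<in> free_alg \<Longrightarrow> g \<in> free_alg \<Longrightarrow> free_add f g \<in> free_alg"
  unfolding free_alg_def free_add_def
  by (auto elim!: finite_subset[rotated, OF finite_UnI, of "{w. f w \<noteq> 0}" "{w. g w \<noteq> 0}"])

lemma free_smul_free_alg: "f \<in> free_alg \<Longrightarrow> free_smul c f \<in> free_alg"
  unfolding free_alg_def free_smul_def by (auto elim: finite_subset[rotated])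

lemma free_diff_free_alg: "f \<in> free_alg \<Longrightarrow> g \<in> free_alg \<Longrightarrow> free_diff f g \<in> free_alg"
  by (simp add: free_diff_eq free_add_free_alg free_smul_free_alg)

lemma free_zero_free_alg: "free_zero \<in> free_alg"
  by (simp add: free_zero_def free_alg_def)

lemma free_mult_support:
  "{w. free_mult f g w \<noteq> 0} \<subseteq> (\<lambda>(u, v). u @ v) ` ({w. f w \<noteq> 0} \<times> {w. g w \<noteq> 0})"
proof
  fix w assume "w \<in> {w. free_mult f g w \<noteq> 0}"
  then obtain k where "f (take k w) * g (drop k w) \<noteq> 0"
    unfolding free_mult_def by (auto elim!: sum.not_neutral_contains_not_neutral)
  then show "w \<in> (\<lambda>(u, v). u @ v) ` ({w. f w \<noteq> 0} \<times> {w. g w \<noteq> 0})"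
    by (auto intro!: image_eqI[of _ _ "(take k w, drop k w)"])
qed

lemma free_mult_free_alg: "f \<in> free_alg \<Longrightarrow> g \<in> free_alg \<Longrightarrow> free_mult f g \<in> free_alg"
  unfolding free_alg_def mem_Collect_eq by (rule finite_subset[OF free_mult_support]) auto

context unital_alg
begin

text \<open>The map given by the universal property of the free algebra, meaningful on
  \<open>free_alg\<close>, where the support is finite.\<close>

definition free_eval :: "('i \<Rightarrow> 'r) \<Rightarrow> ('i list \<Rightarrow> 'a) \<Rightarrow> 'r" where
  "free_eval x f = (\<Sum>w | f w \<noteq> 0. f w \<odot> prod_list (map x w))"

lemma free_eval_superset:
  "finite W \<Longrightarrow> {w. f w \<noteq> 0} \<subseteq> W \<Longrightarrow> free_eval x f = (\<Sum>w\<in>W. f w \<odot> prod_list (map x w))"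
  unfolding free_eval_def by (intro sum.mono_neutral_left) auto

lemma free_eval_mono_word: "free_eval x (mono_word w) = prod_list (map x w)"
  by (subst free_eval_superset[of "{w}"]) (auto simp: mono_word_def)

lemma free_eval_zero: "free_eval x free_zero = 0"
  by (simp add: free_eval_def free_zero_def)

lemma free_eval_add:
  assumes "f \<in> free_alg" "g \<in> free_alg"
  shows "free_eval x (free_add f g) = free_eval x f + free_eval x g"
proof -
  let ?W = "{w. f w \<noteq> 0} \<union> {w. g w \<noteq> 0}"
  have "finite ?W" using assms by (simp add: free_alg_def)
  then have "free_eval x h = (\<Sum>w\<in>?W. h w \<odot> prod_list (map x w))" if "h \<in> {f, g, free_add f g}" for h
    using that by (intro free_eval_superset) (auto simp: free_add_def)
  then show ?thesis by (simp add: free_add_def sm_add_left sum.distrib)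
qed

lemma free_eval_smul:
  assumes "f \<in> free_alg"
  shows "free_eval x (free_smul c f) = c \<odot> free_eval x f"
proof -
  have "free_eval x (free_smul c f) = (\<Sum>w | f w \<noteq> 0. free_smul c f w \<odot> prod_list (map x w))"
    using assms by (intro free_eval_superset) (auto simp: free_smul_def free_alg_def)
  then show ?thesis by (simp add: free_eval_def free_smul_def sm_sum_right)
qed

lemma free_eval_diff:
  assumes "f \<in> free_alg" "g \<in> free_alg"
  shows "free_eval x (free_diff f g) = free_eval x f - free_eval x g"
  using assms by (simp add: free_diff_eq free_eval_add free_eval_smul free_smul_free_alg sm_uminus)

lemma free_eval_mult:
  assumes "f \<in> free_alg" "g \<in> free_alg"
  shows "free_eval x (free_mult f g) = free_eval x f * free_eval x g"
proof -
  let ?S = "{w. f w \<noteq> 0}" and ?T = "{w. g w \<noteq> 0}"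
  define W where "W = (\<lambda>(u, v). u @ v) ` (?S \<times> ?T)"
  have fin: "finite ?S" "finite ?T" "finite W" using assms by (auto simp: free_alg_def W_def)
  have W: "u @ v \<in> W" if "f u \<noteq> 0" "g v \<noteq> 0" for u v using that by (auto simp: W_def)
  have "free_eval x (free_mult f g) = (\<Sum>w\<in>W. free_mult f g w \<odot> prod_list (map x w))"
    using fin by (intro free_eval_superset) (auto simp: W_def intro: free_mult_support[THEN subsetD])
  also have "\<dots> = (\<Sum>w\<in>W. \<Sum>k\<le>length w. (f (take k w) * g (drop k w)) \<odot> prod_list (map x w))"
    by (simp add: free_mult_def sm_sum_left)
  also have "\<dots> = (\<Sum>(w, k)\<in>(SIGMA w:W. {..length w}). (f (take k w) * g (drop k w)) \<odot> prod_list (map x w))"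
    using fin by (intro sum.Sigma) auto
  \<comment> \<open>A word with a cutting position is the same as a pair of words; the cuts with
    vanishing coefficient form the discarded set \<open>S'\<close>.\<close>
  also have "\<dots> = (\<Sum>(u, v)\<in>?S \<times> ?T. (f u * g v) \<odot> (prod_list (map x u) * prod_list (map x v)))"
  proof (rule sum.reindex_bij_witness_not_neutral[where
      S' = "{(w, k). (w, k) \<in> (SIGMA w:W. {..length w}) \<and> (f (take k w) * g (drop k w) = 0)}" and T' = "{}"
      and j = "\<lambda>(w, k). (take k w, drop k w)" and i = "\<lambda>(u, v). (u @ v, length u)"])
    show "finite {(w, k). (w, k) \<in> (SIGMA w:W. {..length w}) \<and> (f (take k w) * g (drop k w) = 0)}"
      by (rule finite_subset[of _ "SIGMA w:W. {..length w}"]) (use fin in auto)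
  qed (auto simp: W prod_list.append[symmetric] map_append[symmetric] simp del: prod_list.append map_append)
  also have "\<dots> = (\<Sum>u\<in>?S. \<Sum>v\<in>?T. (f u * g v) \<odot> (prod_list (map x u) * prod_list (map x v)))"
    by (simp add: sum.cartesian_product)
  also have "\<dots> = free_eval x f * free_eval x g"
    by (simp add: free_eval_def sum_product mult.commute[of "f _"])
  finally show ?thesis .
qed

end

section \<open>The ideal of relations\<close>

text \<open>All relations take the shape of a word minus a scalar times a word, which is the shape
  handled by \<open>word_sim_rel\<close>.\<close>

lemma clg_rels_mono_word:
  "clg_rels l \<xi> =
     {free_diff (mono_word (replicate l i)) (free_smul 1 (mono_word [])) | i. True} \<union>
     {free_diff (mono_word (replicate (l - 1) i @ [j, i])) (free_smul \<xi> (mono_word [j])) | i j. i < j} \<union>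
     {free_diff (mono_word (replicate (l - 1) i @ [j, i])) (free_smul (inverse \<xi>) (mono_word [j])) | i j. j < i}"
  unfolding clg_rels_def free_pow_gen unfolding free_gen_eq free_one_eq free_mult_mono_word
  by (simp add: free_smul_def)

text \<open>The easy inclusion, valid for any family \<open>x\<close> obeying the relations; the
  converse for the operator model needs normal words.\<close>

lemma (in unital_alg) gen_ideal_clg_rels_eval:
  fixes x :: "'i::linorder \<Rightarrow> 'r"
  assumes "l > 0" "\<xi> \<noteq> 0" and x_l: "\<And>i. x i ^ l = 1"
    and x_x: "\<And>i j. i < j \<Longrightarrow> x j * x i = \<xi> \<odot> (x i * x j)"
    and "f \<in> gen_ideal (clg_rels l \<xi>)"
  shows "f \<in> free_alg \<and> free_eval x f = 0"
  using assms(5)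
proof induction
  case (gen r a b)
  have x1: "x i ^ (l - 1) * x i = 1" for i using x_l[of i] \<open>l > 0\<close> by (metis power_minus_mult)
  have "r \<in> free_alg \<and> free_eval x r = 0"
  proof -
    consider (power) i where "r = free_diff (mono_word (replicate l i)) (free_smul 1 (mono_word []))"
      | (less) i j where "i < j" "r = free_diff (mono_word (replicate (l - 1) i @ [j, i])) (free_smul \<xi> (mono_word [j]))"
      | (gr) i j where "j < i" "r = free_diff (mono_word (replicate (l - 1) i @ [j, i])) (free_smul (inverse \<xi>) (mono_word [j]))"
      using gen(1) unfolding clg_rels_mono_word by blast
    then show ?thesis
    proof cases
      case power
      then show ?thesis
        by (simp add: free_diff_free_alg free_smul_free_alg free_eval_diff free_eval_smul
            free_eval_mono_word x_l)
    next
      case less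
      have "x i ^ (l - 1) * (x j * x i) = \<xi> \<odot> ((x i ^ (l - 1) * x i) * x j)"
        unfolding x_x[OF less(1)] by (simp add: mult.assoc)
      then show ?thesis using less(2)
        by (simp add: free_diff_free_alg free_smul_free_alg free_eval_diff free_eval_smul
            free_eval_mono_word x1[simplified])
    next
      case gr
      have "x j * x i = inverse \<xi> \<odot> (x i * x j)"
        unfolding x_x[OF gr(1)] using \<open>\<xi> \<noteq> 0\<close> by simp
      then have "x i ^ (l - 1) * (x j * x i) = inverse \<xi> \<odot> ((x i ^ (l - 1) * x i) * x j)"
        by (simp add: mult.assoc)
      then show ?thesis using gr(2)
        by (simp add: free_diff_free_alg free_smul_free_alg free_eval_diff free_eval_smul
            free_eval_mono_word x1[simplified])
    qed
  qed
  then show ?case using gen(2,3) by (simp add: free_mult_free_alg free_eval_mult)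
qed (auto simp: free_zero_free_alg free_eval_zero free_add_free_alg free_eval_add
      free_smul_free_alg free_eval_smul)

lemma gen_ideal_sum:
  "finite W \<Longrightarrow> (\<And>w. w \<in> W \<Longrightarrow> h w \<in> gen_ideal R) \<Longrightarrow> (\<lambda>v. \<Sum>w\<in>W. h w v) \<in> gen_ideal R"
proof (induction W rule: finite_induct)
  case empty
  then show ?case using gen_ideal.zero[of R] by (simp add: free_zero_def)
next
  case (insert w W)
  then have "free_add (h w) (\<lambda>v. \<Sum>w\<in>W. h w v) \<in> gen_ideal R" by (intro gen_ideal.add) auto
  then show ?case using insert by (simp add: free_add_def)
qed

section \<open>Normal words: reduction modulo the relations and linear independence\<close>

locale clg_root =
  fixes l :: nat and \<xi> :: "'a::field"
  assumes l_pos: "l > 0" and root: "\<xi> ^ l = 1"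
begin

lemma root_nonzero: "\<xi> \<noteq> 0"
  using root l_pos by (metis zero_neq_one zero_power)

definition word_eq :: "'a \<Rightarrow> 'i::linorder list \<Rightarrow> 'i list \<Rightarrow> bool" where
  "word_eq c u v \<longleftrightarrow> free_diff (mono_word u) (free_smul c (mono_word v)) \<in> gen_ideal (clg_rels l \<xi>)"

text \<open>Forgetting the value of the scalar keeps the rewriting free of bookkeeping; that it is
  nonzero makes the relation symmetric.\<close>

definition word_sim :: "'i::linorder list \<Rightarrow> 'i list \<Rightarrow> bool" where
  "word_sim u v \<longleftrightarrow> (\<exists>c. c \<noteq> 0 \<and> word_eq c u v)"

lemma word_eq_refl: "word_eq 1 u u"
  unfolding word_eq_def using gen_ideal.zero[of "clg_rels l \<xi>"]
  by (simp add: free_diff_def free_smul_def free_zero_def)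

lemma word_eq_trans:
  assumes "word_eq c u v" "word_eq d v w"
  shows "word_eq (c * d) u w"
proof -
  have "free_diff (mono_word u) (free_smul (c * d) (mono_word w)) =
    free_add (free_diff (mono_word u) (free_smul c (mono_word v)))
      (free_smul c (free_diff (mono_word v) (free_smul d (mono_word w))))"
    by (simp add: fun_eq_iff free_diff_def free_smul_def free_add_def algebra_simps)
  then show ?thesis using assms unfolding word_eq_def by (simp add: gen_ideal.add gen_ideal.smul)
qed

lemma word_eq_sym:
  assumes "word_eq c u v" "c \<noteq> 0"
  shows "word_eq (inverse c) v u"
proof -
  have "free_diff (mono_word v) (free_smul (inverse c) (mono_word u)) =
    free_smul (- inverse c) (free_diff (mono_word u) (free_smul c (mono_word v)))"
    using assms(2) by (simp add: fun_eq_iff free_diff_def free_smul_def algebra_simps)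
  then show ?thesis using assms(1) unfolding word_eq_def by (simp add: gen_ideal.smul)
qed

lemma word_sim_refl: "word_sim u u"
  unfolding word_sim_def using word_eq_refl by (intro exI[of _ 1]) auto

lemma word_sim_trans [trans]: "word_sim u v \<Longrightarrow> word_sim v w \<Longrightarrow> word_sim u w"
  unfolding word_sim_def by (metis word_eq_trans mult_eq_0_iff)

lemma word_sim_sym: "word_sim u v \<Longrightarrow> word_sim v u"
  unfolding word_sim_def by (metis word_eq_sym inverse_zero_imp_zero)

lemma word_sim_rel:
  assumes "free_diff (mono_word a) (free_smul c (mono_word b)) \<in> clg_rels l \<xi>" "c \<noteq> 0"
  shows "word_sim (p @ a @ q) (p @ b @ q)"
proof -
  have "free_mult (free_mult (mono_word p) (free_diff (mono_word a) (free_smul c (mono_word b)))) (mono_word q)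
      \<in> gen_ideal (clg_rels l \<xi>)"
    using assms by (intro gen_ideal.gen) auto
  then have "word_eq c (p @ a @ q) (p @ b @ q)"
    unfolding word_eq_def free_diff_eq free_mult_linear free_mult_mono_word by simp
  then show ?thesis using assms(2) unfolding word_sim_def by blast
qed

lemma word_sim_cancel_power: "word_sim (p @ replicate l i @ q) (p @ q)"
  using word_sim_rel[of "replicate l i" 1 "[]" p q] unfolding clg_rels_mono_word by simp blast

text \<open>Inserting \<open>x_i ^ l\<close>, read as \<open>x_i\<close> times
  \<open>x_i ^ (l - 1)\<close>, in front of \<open>x_j x_i\<close> creates the left side of a
  defining relation, which collapses to leave \<open>x_i x_j\<close>.\<close>

lemma word_sim_swap: "word_sim (p @ j # i # q) (p @ i # j # q)"
proof (cases "i = j")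
  case False
  have "replicate l i = i # replicate (l - 1) i" using l_pos by (cases l) auto
  have 1: "word_sim (p @ j # i # q) (p @ replicate l i @ j # i # q)"
    using word_sim_sym[OF word_sim_cancel_power] by blast
  have "word_sim ((p @ [i]) @ (replicate (l - 1) i @ [j, i]) @ q) ((p @ [i]) @ [j] @ q)"
  proof (cases "i < j")
    case True
    then show ?thesis using root_nonzero
      by (intro word_sim_rel[of _ \<xi>]) (unfold clg_rels_mono_word, blast, simp)
  next
    case False
    then have "j < i" using \<open>i \<noteq> j\<close> by simp
    then show ?thesis using root_nonzero
      by (intro word_sim_rel[of _ "inverse \<xi>"]) (unfold clg_rels_mono_word, blast, simp)
  qed
  with 1 show ?thesis unfolding \<open>replicate l i = _\<close> by (auto intro: word_sim_trans)
qed (simp add: word_sim_refl)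

lemma word_sim_move_front: "word_sim (p @ u @ a # q) (p @ a # u @ q)"
proof (induction u arbitrary: p)
  case (Cons b u)
  have "word_sim (p @ b # u @ a # q) (p @ b # a # u @ q)" using Cons[of "p @ [b]"] by simp
  also have "word_sim (p @ b # a # u @ q) (p @ a # b # u @ q)" by (rule word_sim_swap)
  finally show ?case by simp
qed (simp add: word_sim_refl)

lemma word_sim_perm: "mset u = mset v \<Longrightarrow> word_sim (p @ u) (p @ v)"
proof (induction u arbitrary: p v)
  case (Cons a u)
  then have "a \<in> set v" by (metis list.set_intros(1) mset_eq_setD)
  then obtain v1 v2 where v: "v = v1 @ a # v2" by (meson split_list)
  then have "mset u = mset (v1 @ v2)" using Cons.prems by simp
  then have "word_sim (p @ a # u) (p @ a # v1 @ v2)" using Cons.IH[of "v1 @ v2" "p @ [a]"] by simp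
  also have "word_sim (p @ a # v1 @ v2) (p @ v1 @ a # v2)"
    by (rule word_sim_sym[OF word_sim_move_front])
  finally show ?case by (simp add: v)
qed (simp add: word_sim_refl)

definition normal_word :: "'i::linorder list \<Rightarrow> bool" where
  "normal_word w \<longleftrightarrow> sorted w \<and> (\<forall>i. count (mset w) i < l)"

text \<open>Either sorting suffices, or some \<open>l\<close> equal letters can be gathered and
  cancelled, which shortens the word.\<close>

lemma exists_normal_word: "\<exists>v. normal_word v \<and> word_sim w v"
proof (induction "length w" arbitrary: w rule: less_induct)
  case less
  show ?case
  proof (cases "\<forall>i. count (mset w) i < l")
    case True
    then show ?thesis using word_sim_perm[of w "sort w" "[]"]
      by (intro exI[of _ "sort w"]) (auto simp: normal_word_def)
  next
    case False
    then obtain i where "count (mset w) i \<ge> l" by (meson not_less)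
    then have "replicate_mset l i \<subseteq># mset w" by (simp add: count_le_replicate_mset_subset_eq)
    then obtain M where M: "mset w = replicate_mset l i + M" by (auto simp: mset_subset_eq_exists_conv)
    obtain v where v: "mset v = M" using ex_mset by blast
    have "mset w = mset (replicate l i @ v)" using M v by simp
    then have "word_sim w (replicate l i @ v)" using word_sim_perm[of w _ "[]"] by simp
    also have "word_sim (replicate l i @ v) v" using word_sim_cancel_power[of "[]" i v] by simp
    finally have wv: "word_sim w v" .
    have "length w = l + length v"
      using M v by (metis mset_append size_mset mset_replicate length_append length_replicate)
    then obtain v' where "normal_word v'" "word_sim v v'" using less l_pos by (metis less_add_same_cancel2)
    then show ?thesis using wv word_sim_trans by blast
  qed
qed

text \<open>While multiplicities stay below \<open>l\<close> no coordinate wraps around, so each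
  letter simply adds itself to the multiset, up to a phase.\<close>

lemma app_normal_word:
  assumes "\<And>i. count (m + mset w) i < l"
  shows "\<exists>e. \<forall>f. app (prod_list (map (clg_op l \<xi>) w)) f m = \<xi> ^ e * f (m + mset w)"
  using assms
proof (induction w arbitrary: m)
  case Nil
  then show ?case by (auto intro: exI[of _ 0])
next
  case (Cons a w)
  have "Suc (count m a) < l" using Cons.prems[of a] by simp
  then have nx: "next_mset l a m = add_mset a m" by (rule next_mset_eq)
  have "\<exists>e. \<forall>f. app (prod_list (map (clg_op l \<xi>) w)) f (add_mset a m) = \<xi> ^ e * f (add_mset a m + mset w)"
    by (rule Cons.IH) (use Cons.prems in simp)
  then obtain e where "\<And>f. app (prod_list (map (clg_op l \<xi>) w)) f (add_mset a m) = \<xi> ^ e * f (add_mset a m + mset w)"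
    by blast
  then show ?case by (intro exI[of _ "count_above a m + e"]) (auto simp: nx power_add)
qed

lemma gen_ideal_eval:
  fixes f :: "'i::linorder list \<Rightarrow> 'a"
  assumes "f \<in> gen_ideal (clg_rels l \<xi>)"
  shows "f \<in> free_alg" "lop.free_eval (clg_op l \<xi>) f = 0"
  using lop.gen_ideal_clg_rels_eval[of l \<xi> "clg_op l \<xi>", OF l_pos root_nonzero
      clg_op_order[OF root l_pos] clg_op_commute[OF root l_pos] assms]
  by simp_all

text \<open>Applied to the indicator function of \<open>mset v\<close> and evaluated at the empty multiset, a normal
  word \<open>w\<close> gives a nonzero value only if \<open>w = v\<close>.\<close>

lemma normal_combination_eq_zero:
  assumes g: "g \<in> free_alg" and normal: "\<And>w. g w \<noteq> 0 \<Longrightarrow> normal_word w"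
    and "lop.free_eval (clg_op l \<xi>) g = 0"
  shows "g = free_zero"
proof (rule ccontr)
  assume "g \<noteq> free_zero"
  then obtain v where v: "g v \<noteq> 0" by (auto simp: free_zero_def)
  define \<delta> where "\<delta> = (\<lambda>M. if M = mset v then (1::'a) else 0)"
  let ?X = "\<lambda>w. app (prod_list (map (clg_op l \<xi>) w)) \<delta> {#}"
  have X: "\<exists>e. ?X w = \<xi> ^ e * \<delta> (mset w)" if "g w \<noteq> 0" for w
  proof -
    have "\<And>i. count ({#} + mset w) i < l" using normal[OF that] by (simp add: normal_word_def)
    from app_normal_word[OF this] obtain e where
      e: "\<forall>f. app (prod_list (map (clg_op l \<xi>) w)) f {#} = \<xi> ^ e * f ({#} + mset w)" ..
    show ?thesis using spec[OF e, of \<delta>] unfolding add_0 ..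
  qed
  have "(\<Sum>w | g w \<noteq> 0. g w * ?X w) = (\<Sum>w | g w \<noteq> 0. if w = v then g v * ?X v else 0)"
  proof (rule sum.cong[OF refl])
    fix w assume w: "w \<in> {w. g w \<noteq> 0}"
    have "mset w = mset v \<Longrightarrow> w = v"
    proof -
      assume eq: "mset w = mset v"
      have sorted: "sorted w" "sorted v" using normal[of w] normal[of v] w v by (auto simp: normal_word_def)
      have "sort v = w" by (rule properties_for_sort[OF eq sorted(1)])
      then show "w = v" by (simp only: sorted_sort_id[OF sorted(2)])
    qed
    then show "g w * ?X w = (if w = v then g v * ?X v else 0)"
      using X[of w] w by (cases "w = v") (auto simp: \<delta>_def)
  qed
  also have "\<dots> = g v * ?X v" using g v by (simp add: free_alg_def)
  finally have "app (lop.free_eval (clg_op l \<xi>) g) \<delta> {#} = g v * ?X v"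
    by (simp add: lop.free_eval_def app_sum)
  moreover have "?X v \<noteq> 0" using X[OF v] root_nonzero by (auto simp: \<delta>_def)
  ultimately show False using v assms(3) by simp
qed

text \<open>For the converse, \<open>f\<close> is replaced modulo the ideal by a combination
  \<open>g\<close> of normal words. Its evaluation is still zero, so \<open>g\<close> vanishes by
  independence, and \<open>f\<close> lies in the ideal.\<close>

lemma gen_ideal_iff:
  fixes f :: "'i::linorder list \<Rightarrow> 'a"
  shows "f \<in> gen_ideal (clg_rels l \<xi>) \<longleftrightarrow> f \<in> free_alg \<and> lop.free_eval (clg_op l \<xi>) f = 0"
proof
  assume f: "f \<in> free_alg \<and> lop.free_eval (clg_op l \<xi>) f = 0"
  have "\<forall>w :: 'i list. \<exists>v c. normal_word v \<and> word_eq c w v"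
    using exists_normal_word unfolding word_sim_def by blast
  then obtain nf cf where nf: "\<And>w :: 'i list. normal_word (nf w)" "\<And>w. word_eq (cf w) w (nf w)"
    by metis
  let ?S = "{w. f w \<noteq> 0}"
  have fin: "finite ?S" using f by (simp add: free_alg_def)
  \<comment> \<open>\<open>f\<close> with each word exchanged for its normal word and the scalar of
    that reduction.\<close>
  define g where "g = (\<lambda>v. \<Sum>w\<in>?S. f w * (cf w * mono_word (nf w) v))"
  have supp: "\<exists>w\<in>?S. v = nf w" if "g v \<noteq> 0" for v
    using that unfolding g_def mono_word_def
    by (auto elim!: sum.not_neutral_contains_not_neutral split: if_splits)
  then have "{v. g v \<noteq> 0} \<subseteq> nf ` ?S" by blast
  then have g: "g \<in> free_alg" using fin unfolding free_alg_def by (auto elim: finite_subset)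
  have f_eq: "f v = (\<Sum>w\<in>?S. f w * mono_word w v)" for v
    using fin by (simp add: mono_word_def if_distrib[of "\<lambda>x. _ * x"] cong: if_cong)
  have "free_diff f g = (\<lambda>v. \<Sum>w\<in>?S. free_smul (f w) (free_diff (mono_word w) (free_smul (cf w) (mono_word (nf w)))) v)"
    by (rule ext) (simp add: free_diff_def free_smul_def g_def right_diff_distrib sum_subtractf f_eq[symmetric])
  also have "\<dots> \<in> gen_ideal (clg_rels l \<xi>)"
    using fin nf(2) unfolding word_eq_def by (intro gen_ideal_sum gen_ideal.smul) auto
  finally have J: "free_diff f g \<in> gen_ideal (clg_rels l \<xi>)" .
  then have "lop.free_eval (clg_op l \<xi>) g = 0"
    using gen_ideal_eval(2)[OF J] f g by (simp add: lop.free_eval_diff)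
  then have "g = free_zero"
    using normal_combination_eq_zero[OF g] supp nf(1) by blast
  then show "f \<in> gen_ideal (clg_rels l \<xi>)" using J by (simp add: free_diff_def free_zero_def)
qed (use gen_ideal_eval in blast)

end

section \<open>Locally matrix structure\<close>

locale alg_embedding = unital_alg sm
  for sm :: "'a::field \<Rightarrow> 'r::ring_1 \<Rightarrow> 'r" (infixr "\<odot>" 75) +
  fixes A :: "('a, 'b) falg" and \<Psi> :: "'b \<Rightarrow> 'r"
  assumes inj: "inj_on \<Psi> (acarrier A)"
    and zero: "azero A \<in> acarrier A" "\<Psi> (azero A) = 0"
    and one: "aone A \<in> acarrier A" "\<Psi> (aone A) = 1"
    and add: "\<And>X Y. X \<in> acarrier A \<Longrightarrow> Y \<in> acarrier A \<Longrightarrow> aadd A X Y \<in> acarrier A"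
      "\<And>X Y. X \<in> acarrier A \<Longrightarrow> Y \<in> acarrier A \<Longrightarrow> \<Psi> (aadd A X Y) = \<Psi> X + \<Psi> Y"
    and mul: "\<And>X Y. X \<in> acarrier A \<Longrightarrow> Y \<in> acarrier A \<Longrightarrow> amul A X Y \<in> acarrier A"
      "\<And>X Y. X \<in> acarrier A \<Longrightarrow> Y \<in> acarrier A \<Longrightarrow> \<Psi> (amul A X Y) = \<Psi> X * \<Psi> Y"
    and smul: "\<And>c X. X \<in> acarrier A \<Longrightarrow> asmul A c X \<in> acarrier A"
      "\<And>c X. X \<in> acarrier A \<Longrightarrow> \<Psi> (asmul A c X) = c \<odot> \<Psi> X"
begin

lemma embedding_eqI: "X \<in> acarrier A \<Longrightarrow> Y \<in> acarrier A \<Longrightarrow> \<Psi> X = \<Psi> Y \<Longrightarrow> X = Y"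
  using inj by (rule inj_onD)

lemma unital_algebra: "unital_algebra A"
proof -
  have "\<exists>Y\<in>acarrier A. aadd A X Y = azero A" if "X \<in> acarrier A" for X
    using that by (intro bexI[of _ "asmul A (- 1) X"] embedding_eqI) (simp_all add: zero add smul sm_uminus)
  then show ?thesis
    unfolding unital_algebra_def
    by (auto intro!: embedding_eqI
        simp: zero one add mul smul algebra_simps sm_add_left sm_add_right)
qed

lemma matrix_subalgebra_mspan:
  assumes E: "munits N E" and sub: "mspan N E \<subseteq> \<Psi> ` acarrier A"
  shows "matrix_subalgebra A N {X \<in> acarrier A. \<Psi> X \<in> mspan N E}"
proof -
  define B where "B = {X \<in> acarrier A. \<Psi> X \<in> mspan N E}"
  define L where "L = (\<lambda>M. lincomb N E (\<lambda>i j. M $$ (i, j)))"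
  \<comment> \<open>The span lies in the image of \<open>\<Psi>\<close>, so each combination has a
    preimage, unique by injectivity.\<close>
  define \<phi> where "\<phi> = (\<lambda>M. inv_into (acarrier A) \<Psi> (L M))"
  have L: "L M \<in> mspan N E" for M by (auto simp: L_def mspan_def)
  have \<phi>: "\<phi> M \<in> acarrier A" "\<Psi> (\<phi> M) = L M" for M
    using sub L[of M] unfolding \<phi>_def by (auto intro!: inv_into_into f_inv_into_f)
  have \<phi>I: "\<phi> M = X" if "X \<in> acarrier A" "\<Psi> X = L M" for M X
    using that \<phi> by (intro embedding_eqI) auto
  have "subalgebra A B"
    unfolding subalgebra_def B_def
    by (auto simp: zero add mul smul mspan_zero mspan_add mspan_mult[OF E] mspan_smult)
  moreover have "aone A \<in> B" by (simp add: B_def one mspan_one[OF E])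
  moreover have "bij_betw \<phi> (carrier_mat N N) B"
    unfolding bij_betw_def
  proof
    show "inj_on \<phi> (carrier_mat N N)"
    proof (rule inj_onI)
      fix M M' assume M: "M \<in> carrier_mat N N" "M' \<in> carrier_mat N N" and "\<phi> M = \<phi> M'"
      then have "L M = L M'" using \<phi>(2) by metis
      then have "M $$ (i, j) = M' $$ (i, j)" if "i < N" "j < N" for i j
        using lincomb_inject[OF E zero_neq_one[symmetric]] that unfolding L_def by blast
      then show "M = M'" using M by (intro eq_matI) auto
    qed
    show "\<phi> ` carrier_mat N N = B"
    proof
      show "\<phi> ` carrier_mat N N \<subseteq> B" using \<phi> L by (auto simp: B_def)
      show "B \<subseteq> \<phi> ` carrier_mat N N"
      proof
        fix X assume X: "X \<in> B"
        then obtain \<alpha> where \<alpha>: "\<Psi> X = lincomb N E \<alpha>" by (auto simp: B_def mspan_def)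
        have "\<phi> (mat N N (\<lambda>(i, j). \<alpha> i j)) = X"
          using X \<alpha> by (intro \<phi>I) (auto simp: B_def L_def intro!: lincomb_cong)
        then show "X \<in> \<phi> ` carrier_mat N N" by (metis imageI mat_carrier)
      qed
    qed
  qed
  moreover have "\<phi> (1\<^sub>m N) = aone A"
  proof (rule \<phi>I)
    have "L (1\<^sub>m N) = lincomb N E (\<lambda>i j. if i = j then 1 else 0)"
      unfolding L_def by (intro lincomb_cong) simp
    then show "\<Psi> (aone A) = L (1\<^sub>m N)" by (simp add: one lincomb_one[OF E])
  qed (rule one)
  moreover have "\<phi> (M + M') = aadd A (\<phi> M) (\<phi> M')" if "M \<in> carrier_mat N N" "M' \<in> carrier_mat N N" for M M'
    using that by (intro \<phi>I) (auto simp: add \<phi> L_def lincomb_add intro!: lincomb_cong)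
  moreover have "\<phi> (M * M') = amul A (\<phi> M) (\<phi> M')" if "M \<in> carrier_mat N N" "M' \<in> carrier_mat N N" for M M'
    using that by (intro \<phi>I)
      (auto simp: mul \<phi> L_def lincomb_mult[OF E] scalar_prod_def atLeast0LessThan intro!: lincomb_cong)
  moreover have "\<phi> (c \<cdot>\<^sub>m M) = asmul A c (\<phi> M)" if "M \<in> carrier_mat N N" for M c
    using that by (intro \<phi>I) (auto simp: smul \<phi> L_def lincomb_smult intro!: lincomb_cong)
  ultimately show ?thesis unfolding matrix_subalgebra_def B_def[symmetric] by blast
qed

end

section \<open>The presented algebra as an algebra of operators\<close>

context clg_root
begin

abbreviation clg_eval :: "('i::linorder list \<Rightarrow> 'a) \<Rightarrow> ('i multiset, 'a) lop" where
  "clg_eval \<equiv> lop.free_eval (clg_op l \<xi>)"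

abbreviation clg_coset :: "('i::linorder list \<Rightarrow> 'a) \<Rightarrow> ('i list \<Rightarrow> 'a) set" where
  "clg_coset \<equiv> coset_of (gen_ideal (clg_rels l \<xi>))"

definition embed :: "('i::linorder list \<Rightarrow> 'a) set \<Rightarrow> ('i multiset, 'a) lop" where
  "embed X = clg_eval (rep_of X)"

text \<open>Cosets of the ideal are fibres of the evaluation; hence the choice made by
  \<open>rep_of\<close> affects neither \<open>embed\<close> nor the operations.\<close>

lemma clg_coset_eq: "f \<in> free_alg \<Longrightarrow> clg_coset f = {g \<in> free_alg. clg_eval g = clg_eval f}"
  unfolding coset_of_def
  by (auto simp: gen_ideal_iff free_diff_free_alg lop.free_eval_diff)

lemma rep_of_clg_coset:
  assumes "f \<in> free_alg"
  shows "rep_of (clg_coset f) \<in> free_alg" "clg_eval (rep_of (clg_coset f)) = clg_eval f"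
proof -
  have "f \<in> clg_coset f" using assms by (simp add: clg_coset_eq)
  then have "rep_of (clg_coset f) \<in> clg_coset f"
    unfolding rep_of_def by (rule someI[of "\<lambda>g. g \<in> clg_coset f"])
  then show "rep_of (clg_coset f) \<in> free_alg" "clg_eval (rep_of (clg_coset f)) = clg_eval f"
    using assms by (auto simp: clg_coset_eq)
qed

lemma embed_clg_coset: "f \<in> free_alg \<Longrightarrow> embed (clg_coset f) = clg_eval f"
  by (simp add: embed_def rep_of_clg_coset)

lemma Clg_simps:
  "acarrier (Clg l \<xi>) = clg_coset ` free_alg"
  "aadd (Clg l \<xi>) = (\<lambda>X Y. clg_coset (free_add (rep_of X) (rep_of Y)))"
  "amul (Clg l \<xi>) = (\<lambda>X Y. clg_coset (free_mult (rep_of X) (rep_of Y)))"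
  "asmul (Clg l \<xi>) = (\<lambda>c X. clg_coset (free_smul c (rep_of X)))"
  "azero (Clg l \<xi>) = clg_coset free_zero"
  "aone (Clg l \<xi>) = clg_coset free_one"
  by (simp_all add: Clg_def presented_alg_def Let_def)

lemma Clg_embedding: "alg_embedding scale_lop (Clg l \<xi>) embed"
proof
  show "inj_on embed (acarrier (Clg l \<xi>))"
    by (auto intro!: inj_onI simp: Clg_simps embed_clg_coset) (auto simp: clg_coset_eq)
  show "azero (Clg l \<xi>) \<in> acarrier (Clg l \<xi>)" "embed (azero (Clg l \<xi>)) = 0"
    "aone (Clg l \<xi>) \<in> acarrier (Clg l \<xi>)" "embed (aone (Clg l \<xi>)) = 1"
    by (auto simp: Clg_simps embed_clg_coset free_zero_free_alg free_one_eq lop.free_eval_zero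
        lop.free_eval_mono_word)
qed (auto simp: Clg_simps embed_clg_coset rep_of_clg_coset free_add_free_alg free_mult_free_alg
    free_smul_free_alg lop.free_eval_add lop.free_eval_mult lop.free_eval_smul)

lemma embed_image: "embed ` acarrier (Clg l \<xi>) = clg_eval ` free_alg"
  by (auto simp: Clg_simps image_image embed_clg_coset)

end

section \<open>Steinitz numbers and assembly of the proof\<close>

lemma exists_even_superset:
  assumes "infinite (UNIV :: 'i set)" "finite (S :: 'i set)"
  obtains T where "finite T" "S \<subseteq> T" "even (card T)"
proof (cases "even (card S)")
  case False
  obtain i where "i \<notin> S" using assms by (metis ex_new_if_finite)
  then show ?thesis using assms False that[of "insert i S"] by auto
qed (use assms that in blast)

lemma steinitz_lcm_eq_steinitz_inf:
  assumes powers: "\<And>m. l ^ m \<in> S" and dvd: "\<And>n. n \<in> S \<Longrightarrow> \<exists>m. n dvd l ^ m" and "l > 0"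
  shows "steinitz_lcm S = steinitz_inf l"
proof
  fix p :: nat
  show "steinitz_lcm S p = steinitz_inf l p"
  proof (cases "prime p")
    case p: True
    show ?thesis
    proof (cases "p dvd l")
      case True
      have "enat m \<le> (SUP n\<in>S. enat (multiplicity p n))" for m
      proof -
        have "multiplicity p l \<ge> 1"
          using True p \<open>l > 0\<close> by (simp add: Suc_le_eq prime_multiplicity_gt_zero_iff)
        then have "m \<le> multiplicity p (l ^ m)"
          using p \<open>l > 0\<close> by (simp add: prime_elem_multiplicity_power_distrib)
        then have "enat m \<le> enat (multiplicity p (l ^ m))" by simp
        also have "\<dots> \<le> (SUP n\<in>S. enat (multiplicity p n))" using powers by (rule SUP_upper)
        finally show ?thesis .
      qed
      \<comment> \<open>Only \<open>\<infinity>\<close> lies above every natural number.\<close>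
      then have "(SUP n\<in>S. enat (multiplicity p n)) = \<infinity>"
        by (metis enat_ord_simps(1) not_less_eq_eq order_refl not_infinity_eq)
      then show ?thesis using p True by (simp add: steinitz_lcm_def steinitz_inf_def)
    next
      case False
      have "multiplicity p n = 0" if n: "n \<in> S" for n
      proof -
        obtain m where "n dvd l ^ m" using dvd[OF n] by blast
        then have "\<not> p dvd n" using False p by (meson dvd_trans prime_dvd_power)
        then show ?thesis by (rule not_dvd_imp_multiplicity_0)
      qed
      then have "(SUP n\<in>S. enat (multiplicity p n)) \<le> 0" by (intro SUP_least) (simp add: zero_enat_def)
      then show ?thesis using p False by (simp add: steinitz_lcm_def steinitz_inf_def)
    qed
  qed (simp add: steinitz_lcm_def steinitz_inf_def)
qed

theorem theorem7:
  fixes l :: nat and \<xi> :: "'a::alg_closed_field"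
  assumes "l > 1"
    and "CHAR('a) = 0 \<or> coprime l CHAR('a)"
    and "\<xi> ^ l = 1" and "\<forall>k. 0 < k \<and> k < l \<longrightarrow> \<xi> ^ k \<noteq> 1"
    and "infinite (UNIV :: 'i::linorder set)"
  shows "unital_algebra (Clg l \<xi> :: ('a, ('i list \<Rightarrow> 'a) set) falg) \<and>
         locally_matrix (Clg l \<xi> :: ('a, ('i list \<Rightarrow> 'a) set) falg) \<and>
         steinitz_number (Clg l \<xi> :: ('a, ('i list \<Rightarrow> 'a) set) falg) = steinitz_inf l"
proof -
  interpret clg_root l \<xi> using assms(1,3) by unfold_locales auto
  let ?A = "Clg l \<xi> :: ('a, ('i list \<Rightarrow> 'a) set) falg"
  let ?Q = "clg_eval ` (free_alg :: ('i list \<Rightarrow> 'a) set)"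
  interpret emb: alg_embedding scale_lop ?A embed by (rule Clg_embedding)
  \<comment> \<open>In characteristic 0 this follows from \<open>l > 1\<close>; otherwise
    coprimality prevents the characteristic from dividing \<open>l\<close>.\<close>
  have char: "of_nat l \<noteq> (0::'a)"
  proof
    assume "of_nat l = (0::'a)"
    then have "CHAR('a) dvd l" by (simp add: of_nat_eq_0_iff_char_dvd)
    then have "CHAR('a) = 1" using assms(1,2) by (auto dest: coprime_common_divisor[of _ _ "CHAR('a)"])
    then show False using CHAR_not_1'[where 'a = 'a] by simp
  qed
  interpret gens: clifford_generators scale_lop l \<xi> "clg_op l \<xi> :: 'i \<Rightarrow> _" ?Q
  proof
    show "1 \<in> ?Q" by (rule image_eqI[of _ _ "mono_word []"]) (auto simp: lop.free_eval_mono_word)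
    show "clg_op l \<xi> i \<in> ?Q" for i
      by (rule image_eqI[of _ _ "mono_word [i]"]) (auto simp: lop.free_eval_mono_word)
    show "a + b \<in> ?Q" if "a \<in> ?Q" "b \<in> ?Q" for a b
      using that by (auto simp: lop.free_eval_add[symmetric] free_add_free_alg)
    show "a * b \<in> ?Q" if "a \<in> ?Q" "b \<in> ?Q" for a b
      using that by (auto simp: lop.free_eval_mult[symmetric] free_mult_free_alg)
    show "scale_lop c a \<in> ?Q" if "a \<in> ?Q" for a c
      using that by (auto simp: lop.free_eval_smul[symmetric] free_smul_free_alg)
    show "clg_op l \<xi> j * clg_op l \<xi> i = scale_lop \<xi> (clg_op l \<xi> i * clg_op l \<xi> j)" if "i < j" for i j :: 'i
      by (rule clg_op_commute[OF assms(3) l_pos that])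
  qed (use assms(3,4) char clg_op_order[OF assms(3) l_pos] in auto)
  \<comment> \<open>The second clause says that everything expressible in the letters of
    \<open>S\<close> lands in \<open>C\<close>; it is what captures finite sets.\<close>
  have matrix: "\<exists>C. matrix_subalgebra ?A (l ^ (card S div 2)) C \<and>
      (\<forall>f\<in>free_alg. (\<forall>w. f w \<noteq> 0 \<longrightarrow> set w \<subseteq> S) \<longrightarrow> clg_coset f \<in> C)"
    if S: "finite S" "even (card S)" for S :: "'i set"
  proof -
    define N where "N = l ^ (card S div 2)"
    have "sorted_wrt (<) (sorted_list_of_set S)" "even (length (sorted_list_of_set S))"
      using S by auto
    from gens.exists_munits[OF this] obtain E where E: "lop.munits N E"
      and EQ: "\<And>i j. i < N \<Longrightarrow> j < N \<Longrightarrow> E i j \<in> ?Q"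
      and xs: "clg_op l \<xi> ` S \<subseteq> lop.mspan N E"
      using S unfolding N_def by auto
    let ?C = "{X \<in> acarrier ?A. embed X \<in> lop.mspan N E}"
    have "lop.mspan N E \<subseteq> embed ` acarrier ?A"
      unfolding embed_image by (rule gens.mspan_subset_Q[OF EQ])
    then have "matrix_subalgebra ?A N ?C" by (rule emb.matrix_subalgebra_mspan[OF E])
    moreover have "clg_coset f \<in> ?C" if f: "f \<in> free_alg" "\<forall>w. f w \<noteq> 0 \<longrightarrow> set w \<subseteq> S" for f
    proof -
      have w: "prod_list (map (clg_op l \<xi>) w) \<in> lop.mspan N E" if "set w \<subseteq> S" for w
        using that xs by (induction w) (auto intro!: lop.mspan_one[OF E] lop.mspan_mult[OF E])
      have "clg_eval f \<in> lop.mspan N E"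
        unfolding lop.free_eval_def using f(2) by (intro lop.mspan_sum lop.mspan_smult w) auto
      then show ?thesis using f(1) by (simp add: embed_clg_coset Clg_simps)
    qed
    ultimately show ?thesis unfolding N_def by blast
  qed
  have local: "\<exists>m C. X \<subseteq> C \<and> matrix_subalgebra ?A (l ^ m) C"
    if X: "X \<subseteq> acarrier ?A" "finite X" for X
  proof -
    obtain F where F: "F \<subseteq> free_alg" "finite F" "X = clg_coset ` F"
      using finite_subset_image[OF X(2), of clg_coset free_alg] X(1) by (auto simp: Clg_simps)
    \<comment> \<open>The letters in the chosen representatives, finitely many by finite support.
      The set is then padded to even cardinality because generators are adjoined in pairs.\<close>
    define S where "S = (\<Union>f\<in>F. \<Union>w\<in>{w. f w \<noteq> 0}. set w)"
    have "finite S" using F unfolding S_def free_alg_def by auto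
    then obtain T where T: "finite T" "S \<subseteq> T" "even (card T)"
      using exists_even_superset assms(5) by metis
    from matrix[OF T(1,3)] obtain C where C: "matrix_subalgebra ?A (l ^ (card T div 2)) C"
      "\<forall>f\<in>free_alg. (\<forall>w. f w \<noteq> 0 \<longrightarrow> set w \<subseteq> T) \<longrightarrow> clg_coset f \<in> C" by blast
    have "clg_coset f \<in> C" if "f \<in> F" for f
    proof (rule C(2)[rule_format])
      show "f \<in> free_alg" using F(1) that by blast
      show "set w \<subseteq> T" if "f w \<noteq> 0" for w
        using T(2) \<open>f \<in> F\<close> that unfolding S_def by blast
    qed
    then have "X \<subseteq> C" unfolding F(3) by blast
    then show ?thesis using C(1) by blast
  qed
  have unital: "unital_algebra ?A" by (rule emb.unital_algebra)
  moreover have "locally_matrix ?A"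
    unfolding locally_matrix_def
  proof (intro conjI allI impI unital)
    fix X assume "X \<subseteq> acarrier ?A \<and> finite X"
    then obtain m C where "X \<subseteq> C" "matrix_subalgebra ?A (l ^ m) C" using local[of X] by meson
    then show "\<exists>n B. n \<ge> 1 \<and> X \<subseteq> B \<and> matrix_subalgebra ?A n B"
      using l_pos by (intro exI[of _ "l ^ m"] exI[of _ C]) simp
  qed
  moreover have "steinitz_number ?A = steinitz_inf l"
    unfolding steinitz_number_def
  proof (rule steinitz_lcm_eq_steinitz_inf)
    fix m
    \<comment> \<open>An infinite index set offers \<open>2 * m\<close> generators, which yield
      matrices of size \<open>l ^ m\<close>.\<close>
    obtain S :: "'i set" where S: "finite S" "card S = 2 * m"
      using infinite_arbitrarily_large[OF assms(5)] by blast
    then show "l ^ m \<in> D_set ?A" using matrix[of S] l_pos by (auto simp: D_set_def)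
  next
    fix n assume "n \<in> D_set ?A"
    then obtain B where n: "n \<ge> 1" "matrix_subalgebra ?A n B" by (auto simp: D_set_def)
    \<comment> \<open>An arbitrary unital copy \<open>B\<close> is enclosed in some \<open>C\<close>
      of size \<open>l ^ m\<close> through its finite spanning set, and then the sizes
      divide.\<close>
    obtain X where X: "finite X" "X \<subseteq> B" "\<And>C. subalgebra ?A C \<Longrightarrow> X \<subseteq> C \<Longrightarrow> B \<subseteq> C"
      using matrix_subalgebra_finitely_generated[OF n(2)] by blast
    have "X \<subseteq> acarrier ?A" using X(2) n(2) by (auto simp: matrix_subalgebra_def subalgebra_def)
    then obtain m C where C: "X \<subseteq> C" "matrix_subalgebra ?A (l ^ m) C"
      using local[of X] X(1) by meson
    then have "B \<subseteq> C" by (intro X(3)) (simp_all add: matrix_subalgebra_def)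
    then have "n dvd l ^ m" using n C(2) by (intro matrix_subalgebra_dvd) auto
    then show "\<exists>m. n dvd l ^ m" ..
  qed (rule l_pos)
  ultimately show ?thesis by blast
qed

end
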